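(* Let $f,u:\mathbb{R}^n\to\mathbb{R}$ be compactly supported continuous functions. Then $\mathcal{L}_a u=-f$ in $\mathbb{R}^n$ (i.e. $u$ is an asymptotic average solution to $\mathcal{L}u=-f$ in $\mathbb{R}^n$) if and only if $\mathcal{L}u=-f$ in $\mathcal{D}'(\mathbb{R}^n)$ (i.e. in the weak sense of distributions).
   Context: Setting. Let $\mathcal{L}=\sum_{i,j=1}^n \partial_{x_i}(a_{ij}(x)\partial_{x_j})+\sum_{i=1}^n b_i(x)\partial_{x_i}$ in $\mathbb{R}^n$, with $a_{ij},b_i\in C^\infty(\mathbb{R}^n)$ real-valued. The matrix $A(x)=(a_{ij}(x))$ is symmetric and non-negative definite at every point, and $\inf_{\mathbb{R}^n}a_{11}>0$. Assume $\mathcal{L}$ is hypoelliptic (any distribution $u$ on an open set with $\mathcal{L}u$ smooth is itself smooth) and is endowed with a non-negative smooth fundamental solution $\Gamma:\{(x,y)\in\mathbb{R}^n\times\mathbb{R}^n : x\neq y\}\to\mathbb{R}$ such that: (i) for any fixed $x\in\mathbb{R}^n$, $\Gamma(\cdot,x)$ and $\Gamma(x,\cdot)$ belong to $L^1_{\rm loc}(\mathbb{R}^n)$; (ii) for every $\varphi\in C_0^\infty(\mathbb{R}^n)$ and $x\in\mathbb{R}^n$, $\mathcal{L}\int_{\mathbb{R}^n}\Gamma(x,y)\varphi(y)\,dy=\int_{\mathbb{R}^n}\Gamma(x,y)\mathcal{L}\varphi(y)\,dy=-\varphi(x)$; (iii) $\limsup_{x\to y}\Gamma(x,y)=\infty$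 for every $y$ and $\limsup_{y\to x}\Gamma(x,y)=\infty$ for every $x$; (iv) for every real $M>0$, $\lim_{|x|\to\infty}\big(\sup_{|y|\le M}\Gamma(x,y)\big)=\lim_{|y|\to\infty}\big(\sup_{|x|\le M}\Gamma(x,y)\big)=0$. For $x\in\mathbb{R}^n$ and $r>0$, the $\mathcal{L}$-ball of center $x$ and radius $r$ is $\Omega_r(x)=\{y\in\mathbb{R}^n,\ y\ne x : \Gamma(x,y)>1/r\}$. Define $$M_r(u)(x)=\frac1r\int_{\Omega_r(x)}u(y)\frac{\langle A(y)\nabla_y\Gamma(x,y),\nabla_y\Gamma(x,y)\rangle}{(\Gamma(x,y))^2}\,dy,$$ $$N_r(w)(x)=\frac1r\int_0^r\left(\int_{\Omega_\rho(x)}\Big(\Gamma(x,y)-\frac1\rho\Big)w(y)\,dy\right)d\rho,$$ and $Q_r(x)=N_r(1)(x)$. It is also assumed that the following Poisson--Jensen-type formula holds: for every open $\Omega\subseteq\mathbb{R}^n$, every $u\in C^2(\Omega)$ and every $\mathcal{L}$-ball with $\overline{\Omega_r(x)}\subseteq\Omega$, $u(x)=M_r(u)(x)-N_r(\mathcal{L}u)(x)$. Definition. For $u,f$ continuous in an open set $\Omega\subseteq\mathbb{R}^n$, $u$ is an asymptotic average solution to $\mathcal{L}u=f$ in $\Omega$ (also written $\mathcal{L}_a u=f$ in $\Omega$) if $\mathcal{L}_a u(x):=\lim_{r\to0}\frac{M_r(u)(x)-u(x)}{Q_r(x)}$ exists in $\mathbb{R}$ at every $x\in\Omega$ and $\mathcal{L}_a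 u(x)=f(x)$ for every $x\in\Omega$. The identity $\mathcal{L}u=-f$ in $\mathcal{D}'(\mathbb{R}^n)$ means $\int_{\mathbb{R}^n}u\,\mathcal{L}^*\varphi\,dx=-\int_{\mathbb{R}^n}f\varphi\,dx$ for every $\varphi\in C_0^\infty(\mathbb{R}^n)$, where $\mathcal{L}^*\varphi=\sum_{i,j}\partial_{x_i}(a_{ij}\partial_{x_j}\varphi)-\sum_i\partial_{x_i}(b_i\varphi)$. *)

theory Defs
  imports "HOL-Analysis.Analysis"
begin

definition dir_deriv :: "'a::euclidean_space \<Rightarrow> ('a \<Rightarrow> real) \<Rightarrow> 'a \<Rightarrow> real" where
  "dir_deriv v f x = frechet_derivative f (at x) v"

abbreviation partial :: "'n::finite \<Rightarrow> (real^'n \<Rightarrow> real) \<Rightarrow> real^'n \<Rightarrow> real" where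
  "partial i \<equiv> dir_deriv (axis i 1)"

text \<open>For \<open>vs = [v1, \<dots>, vm]\<close> in \<open>Basis\<close> this is the iterated partial derivative of order \<open>m\<close>
  along \<open>vm, \<dots>, v1\<close> in turn. Lists of basis vectors play the role of multi-indices.\<close>

primrec iter_deriv :: "'a::euclidean_space list \<Rightarrow> ('a \<Rightarrow> real) \<Rightarrow> 'a \<Rightarrow> real" where
  "iter_deriv [] f = f"
| "iter_deriv (v # vs) f = dir_deriv v (iter_deriv vs f)"

text \<open>Only meant for open \<open>S\<close>: derivatives are taken in the ambient space, so for open \<open>S\<close> the
  values of \<open>f\<close> outside \<open>S\<close> are irrelevant. The differentiability clause is what guarantees that
  the derivatives occurring in the first clause are genuine.\<close>

definition Ck_on :: "nat \<Rightarrow> 'a::euclidean_space set \<Rightarrow> ('a \<Rightarrow> real) \<Rightarrow> bool" where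
  "Ck_on k S f \<longleftrightarrow>
     (\<forall>vs. set vs \<subseteq> Basis \<and> length vs \<le> k \<longrightarrow> continuous_on S (iter_deriv vs f)) \<and>
     (\<forall>vs. set vs \<subseteq> Basis \<and> length vs < k \<longrightarrow> (\<forall>x\<in>S. iter_deriv vs f differentiable (at x)))"

definition smooth_on :: "'a::euclidean_space set \<Rightarrow> ('a \<Rightarrow> real) \<Rightarrow> bool" where
  "smooth_on S f \<longleftrightarrow> (\<forall>k. Ck_on k S f)"

abbreviation supp :: "('a::euclidean_space \<Rightarrow> real) \<Rightarrow> 'a set" where
  "supp f \<equiv> closure (support_on UNIV f)"

text \<open>The space \<open>C\<^sub>0\<^sup>\<infinity>(S)\<close>; its elements are extended by zero to the whole space.\<close>

definition test_functions :: "'a::euclidean_space set \<Rightarrow> ('a \<Rightarrow> real) set" where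
  "test_functions S = {\<phi>. smooth_on UNIV \<phi> \<and> compact (supp \<phi>) \<and> supp \<phi> \<subseteq> S}"

text \<open>A (real) distribution on an open set \<open>S\<close> is a linear functional on the test functions
  satisfying, on every compact subset of \<open>S\<close>, an estimate by finitely many of the usual
  seminorms. Its values on functions that are not test functions are irrelevant.\<close>

definition distribution_on :: "'a::euclidean_space set \<Rightarrow> (('a \<Rightarrow> real) \<Rightarrow> real) \<Rightarrow> bool" where
  "distribution_on S T \<longleftrightarrow>
     (\<forall>\<phi>\<in>test_functions S. \<forall>\<psi>\<in>test_functions S. T (\<lambda>x. \<phi> x + \<psi> x) = T \<phi> + T \<psi>) \<and>
     (\<forall>c. \<forall>\<phi>\<in>test_functions S. T (\<lambda>x. c * \<phi> x) = c * T \<phi>) \<and>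
     (\<forall>K. compact K \<and> K \<subseteq> S \<longrightarrow>
        (\<exists>C N. \<forall>\<phi>\<in>test_functions S. supp \<phi> \<subseteq> K \<longrightarrow>
           \<bar>T \<phi>\<bar> \<le> C * (\<Sum>vs | set vs \<subseteq> Basis \<and> length vs \<le> N. SUP x. \<bar>iter_deriv vs \<phi> x\<bar>)))"

definition regular_distr :: "('a::euclidean_space \<Rightarrow> real) \<Rightarrow> ('a \<Rightarrow> real) \<Rightarrow> real" where
  "regular_distr g \<phi> = (LINT x|lborel. g x * \<phi> x)"

definition L_op ::
  "(real^'n \<Rightarrow> real^'n^'n) \<Rightarrow> (real^'n \<Rightarrow> real^'n) \<Rightarrow> (real^'n \<Rightarrow> real) \<Rightarrow> real^'n \<Rightarrow> real" where
  "L_op A b u x =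
     (\<Sum>i\<in>UNIV. \<Sum>j\<in>UNIV. partial i (\<lambda>z. A z $ i $ j * partial j u z) x)
     + (\<Sum>i\<in>UNIV. b x $ i * partial i u x)"

definition L_adj ::
  "(real^'n \<Rightarrow> real^'n^'n) \<Rightarrow> (real^'n \<Rightarrow> real^'n) \<Rightarrow> (real^'n \<Rightarrow> real) \<Rightarrow> real^'n \<Rightarrow> real" where
  "L_adj A b \<phi> x =
     (\<Sum>i\<in>UNIV. \<Sum>j\<in>UNIV. partial i (\<lambda>z. A z $ i $ j * partial j \<phi> z) x)
     - (\<Sum>i\<in>UNIV. partial i (\<lambda>z. b z $ i * \<phi> z) x)"

text \<open>Weak form of \<open>L T = g\<close> on \<open>S\<close>, obtained by moving \<open>L\<close> onto the test function.\<close>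

definition L_distr_eq ::
  "(real^'n \<Rightarrow> real^'n^'n) \<Rightarrow> (real^'n \<Rightarrow> real^'n) \<Rightarrow> (real^'n) set \<Rightarrow>
   ((real^'n \<Rightarrow> real) \<Rightarrow> real) \<Rightarrow> (real^'n \<Rightarrow> real) \<Rightarrow> bool" where
  "L_distr_eq A b S T g \<longleftrightarrow> (\<forall>\<phi>\<in>test_functions S. T (L_adj A b \<phi>) = regular_distr g \<phi>)"

definition hypoelliptic ::
  "(real^'n \<Rightarrow> real^'n^'n) \<Rightarrow> (real^'n \<Rightarrow> real^'n) \<Rightarrow> bool" where
  "hypoelliptic A b \<longleftrightarrow>
     (\<forall>S T. open S \<and> distribution_on S T \<and> (\<exists>g. smooth_on S g \<and> L_distr_eq A b S T g) \<longrightarrow>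
        (\<exists>h. smooth_on S h \<and> (\<forall>\<phi>\<in>test_functions S. T \<phi> = regular_distr h \<phi>)))"

definition locally_integrable :: "('a::euclidean_space \<Rightarrow> real) \<Rightarrow> bool" where
  "locally_integrable f \<longleftrightarrow> (\<forall>K. compact K \<longrightarrow> set_integrable lborel K f)"

text \<open>\<open>\<Gamma>\<close> is a total function here, but its values on the diagonal play no role: in particular
  the filter \<open>at y\<close> excludes \<open>y\<close>, and for \<open>norm x > M\<close> the supremum in the last two clauses avoids
  the diagonal. Applying the operator pointwise to the potential of a test function presupposes
  that the potential is of class \<open>C\<^sup>2\<close>, which is therefore spelled out.\<close>

definition fundamental_solution ::
  "(real^'n \<Rightarrow> real^'n^'n) \<Rightarrow> (real^'n \<Rightarrow> real^'n) \<Rightarrow> (real^'n \<Rightarrow> real^'n \<Rightarrow> real) \<Rightarrow> bool" where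
  "fundamental_solution A b \<Gamma> \<longleftrightarrow>
     (\<forall>x y. x \<noteq> y \<longrightarrow> \<Gamma> x y \<ge> 0) \<and>
     smooth_on {(x, y). x \<noteq> y} (\<lambda>(x, y). \<Gamma> x y) \<and>
     (\<forall>x. locally_integrable (\<lambda>y. \<Gamma> y x) \<and> locally_integrable (\<lambda>y. \<Gamma> x y)) \<and>
     (\<forall>\<phi>\<in>test_functions UNIV.
        Ck_on 2 UNIV (\<lambda>x. LINT y|lborel. \<Gamma> x y * \<phi> y) \<and>
        (\<forall>x. L_op A b (\<lambda>x. LINT y|lborel. \<Gamma> x y * \<phi> y) x = - \<phi> x \<and>
             (LINT y|lborel. \<Gamma> x y * L_op A b \<phi> y) = - \<phi> x)) \<and>
     (\<forall>y. Limsup (at y) (\<lambda>x. ereal (\<Gamma> x y)) = \<infinity>) \<and>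
     (\<forall>x. Limsup (at x) (\<lambda>y. ereal (\<Gamma> x y)) = \<infinity>) \<and>
     (\<forall>M>0. ((\<lambda>x. SUP y\<in>cball 0 M. \<Gamma> x y) \<longlongrightarrow> 0) at_infinity) \<and>
     (\<forall>M>0. ((\<lambda>y. SUP x\<in>cball 0 M. \<Gamma> x y) \<longlongrightarrow> 0) at_infinity)"

definition L_ball :: "(real^'n \<Rightarrow> real^'n \<Rightarrow> real) \<Rightarrow> real \<Rightarrow> real^'n \<Rightarrow> (real^'n) set" where
  "L_ball \<Gamma> r x = {y. y \<noteq> x \<and> \<Gamma> x y > 1 / r}"

definition grad :: "(real^'n \<Rightarrow> real) \<Rightarrow> real^'n \<Rightarrow> real^'n" where
  "grad g y = (\<chi> i. partial i g y)"

definition M_avg ::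
  "(real^'n \<Rightarrow> real^'n^'n) \<Rightarrow> (real^'n \<Rightarrow> real^'n \<Rightarrow> real) \<Rightarrow> real \<Rightarrow>
   (real^'n \<Rightarrow> real) \<Rightarrow> real^'n \<Rightarrow> real" where
  "M_avg A \<Gamma> r u x =
     1 / r * (LINT y:L_ball \<Gamma> r x|lborel.
       u y * (((A y *v grad (\<Gamma> x) y) \<bullet> grad (\<Gamma> x) y) / (\<Gamma> x y)\<^sup>2))"

definition N_avg ::
  "(real^'n \<Rightarrow> real^'n \<Rightarrow> real) \<Rightarrow> real \<Rightarrow> (real^'n \<Rightarrow> real) \<Rightarrow> real^'n \<Rightarrow> real" where
  "N_avg \<Gamma> r w x =
     1 / r * (LINT \<rho>:{0<..<r}|lborel. (LINT y:L_ball \<Gamma> \<rho> x|lborel. (\<Gamma> x y - 1 / \<rho>) * w y))"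

definition Q_avg :: "(real^'n \<Rightarrow> real^'n \<Rightarrow> real) \<Rightarrow> real \<Rightarrow> real^'n \<Rightarrow> real" where
  "Q_avg \<Gamma> r x = N_avg \<Gamma> r (\<lambda>_. 1) x"

definition poisson_jensen ::
  "(real^'n \<Rightarrow> real^'n^'n) \<Rightarrow> (real^'n \<Rightarrow> real^'n) \<Rightarrow> (real^'n \<Rightarrow> real^'n \<Rightarrow> real) \<Rightarrow> bool" where
  "poisson_jensen A b \<Gamma> \<longleftrightarrow>
     (\<forall>S u x r. open S \<and> Ck_on 2 S u \<and> r > 0 \<and> closure (L_ball \<Gamma> r x) \<subseteq> S \<longrightarrow>
        u x = M_avg A \<Gamma> r u x - N_avg \<Gamma> r (L_op A b u) x)"

definition asymptotic_average_solution ::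
  "(real^'n \<Rightarrow> real^'n^'n) \<Rightarrow> (real^'n \<Rightarrow> real^'n \<Rightarrow> real) \<Rightarrow> (real^'n) set \<Rightarrow>
   (real^'n \<Rightarrow> real) \<Rightarrow> (real^'n \<Rightarrow> real) \<Rightarrow> bool" where
  "asymptotic_average_solution A \<Gamma> S u f \<longleftrightarrow>
     continuous_on S u \<and> continuous_on S f \<and>
     (\<forall>x\<in>S. ((\<lambda>r. (M_avg A \<Gamma> r u x - u x) / Q_avg \<Gamma> r x) \<longlongrightarrow> f x) (at_right 0))"

end

theory Submission
  imports Defs
begin

text \<open>
  Both properties single out the same function, the potential
  \<open>pot f x = \<integral> \<Gamma> x y * f y dy\<close>: a continuous compactly supported \<open>u\<close> is an asymptotic average
  solution of \<open>L u = - f\<close> if and only if \<open>u = pot f\<close>, and it is a distributional solution if and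
  only if \<open>u = pot f\<close>.

  The potential has both properties. For a test function \<open>f\<close> this is nearly the definition of a
  fundamental solution: \<open>pot f\<close> is of class \<open>C\<^sup>2\<close> with \<open>L (pot f) = - f\<close>, so Green's identity gives
  the weak equation, and the Poisson--Jensen formula gives \<open>M\<^sub>r (pot f) - pot f = - N\<^sub>r f\<close>.
  A merely continuous \<open>f\<close> is approximated in a weighted sense: there are a fixed bump \<open>g \<ge> 0\<close> and
  test functions \<open>\<phi>\<close> with \<open>\<bar>f - \<phi>\<bar> \<le> \<epsilon> g\<close> (\<open>Cc_approximation\<close>). Since \<open>\<Gamma> \<ge> 0\<close>, and likewise the
  kernels of \<open>M\<^sub>r\<close> and \<open>N\<^sub>r\<close> are nonnegative, every error caused by replacing \<open>f\<close> by \<open>\<phi>\<close> is at most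
  \<open>\<epsilon>\<close> times a quantity attached to \<open>g\<close>, which is itself a test function. This one device yields the
  continuity of \<open>pot f\<close> (\<open>pot_continuous\<close>), the weak equation (\<open>pot_solves_weakly\<close>) and the
  averaging identity (\<open>jensen_pot\<close>). As the \<open>L\<close>-balls shrink to their center,
  \<open>N\<^sub>r f / Q\<^sub>r\<close> tends to \<open>f\<close>, so that \<open>pot f\<close> is an asymptotic average solution
  (\<open>pot_asymptotic\<close>).

  Uniqueness rests on a maximum principle (\<open>asymptotic_maximum_principle\<close>): a continuous \<open>w\<close> that
  vanishes at infinity and has asymptotic average operator \<open>0\<close> is \<open>\<le> 0\<close>. Otherwise, for small
  \<open>\<epsilon> > 0\<close> and a bump \<open>g\<close> that is positive on a large ball, \<open>w - \<epsilon> pot g\<close> would attain a global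
  maximum at some point of that ball. There its averages cannot exceed its value, whereas the
  asymptotic average operator takes the value \<open>\<epsilon> g > 0\<close>. For an asymptotic average solution \<open>u\<close> this
  applies to \<open>\<plusminus>(u - pot f)\<close> directly. If \<open>u\<close> is a distributional solution, then \<open>u - pot f\<close> is a weak
  solution of the homogeneous equation, hence smooth by hypoellipticity, hence a classical solution,
  and the Poisson--Jensen formula shows that it equals its averages; so the same
  principle applies (\<open>distributional_solution_eq_pot\<close>).
\<close>

section \<open>Smooth bump functions\<close>

text \<open>The classical function \<open>exp (- 1 / t)\<close>, continued by \<open>0\<close>, together with its quotients by
  powers of \<open>t\<close>, which are what differentiation produces: the family is closed under derivatives up
  to linear combinations.\<close>

definition flat :: "nat \<Rightarrow> real \<Rightarrow> real" where
  "flat k t = (if t \<le> 0 then 0 else exp (- 1 / t) / t ^ k)"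

lemma flat_pos: "t > 0 \<Longrightarrow> flat k t > 0"
  by (simp add: flat_def)

lemma flat_eq_0: "t \<le> 0 \<Longrightarrow> flat k t = 0"
  by (simp add: flat_def)

lemma flat_nonneg: "flat k t \<ge> 0"
  by (simp add: flat_def)

text \<open>One term of the exponential series dominates any power of \<open>1 / t\<close>. Quadratic decay at \<open>0\<close> is
  what differentiability there requires.\<close>

lemma flat_le_square: "flat k t \<le> fact (k + 2) * t\<^sup>2"
proof (cases "t \<le> 0")
  case False
  then have t: "t > 0" by simp
  have "(1 / t) ^ (k + 2) / fact (k + 2) \<le> exp (1 / t)"
  proof -
    have "(\<Sum>n\<in>{k + 2}. (1 / t) ^ n /\<^sub>R fact n) \<le> (\<Sum>n. (1 / t) ^ n /\<^sub>R fact n)"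
      using t by (intro sum_le_suminf summable_exp_generic) auto
    then show ?thesis by (simp add: exp_def divide_inverse mult.commute)
  qed
  then have "exp (- 1 / t) \<le> fact (k + 2) * t ^ (k + 2)"
    using t by (simp add: exp_minus field_simps del: fact_Suc)
  then show ?thesis
    using t by (simp add: flat_def field_simps power_add power2_eq_square del: fact_Suc)
qed (simp add: flat_def)

lemma flat_has_derivative:
  "(flat k has_real_derivative flat (k + 2) t - real k * flat (k + 1) t) (at t)"
proof -
  consider "t < 0" | "t = 0" | "t > 0" by linarith
  then show ?thesis
  proof cases
    case 1
    have "(flat k has_real_derivative 0) (at t)"
    proof (rule has_field_derivative_transform_within_open[where S = "{..<0}"])
      show "((\<lambda>x. 0::real) has_real_derivative 0) (at t)" by simp
    qed (use 1 in \<open>auto simp: flat_def\<close>)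
    with 1 show ?thesis by (simp add: flat_def)
  next
    case 2
    have "((\<lambda>h. (flat k (0 + h) - flat k 0) / h) \<longlongrightarrow> 0) (at 0)"
    proof (rule Lim_null_comparison)
      show "\<forall>\<^sub>F h in at 0. norm ((flat k (0 + h) - flat k 0) / h) \<le> fact (k + 2) * \<bar>h\<bar>"
      proof (rule eventuallyI)
        fix h :: real
        have "\<bar>flat k h\<bar> \<le> (fact (k + 2) * \<bar>h\<bar>) * \<bar>h\<bar>"
          using flat_le_square[of k h] flat_nonneg[of k h]
          by (simp add: power2_eq_square mult.assoc del: fact_Suc)
        then show "norm ((flat k (0 + h) - flat k 0) / h) \<le> fact (k + 2) * \<bar>h\<bar>"
          by (cases "h = 0") (simp_all add: flat_eq_0 pos_divide_le_eq del: fact_Suc)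
      qed
      show "((\<lambda>h. fact (k + 2) * \<bar>h\<bar>) \<longlongrightarrow> 0) (at (0::real))"
        by (auto intro!: tendsto_eq_intros)
    qed
    then have "(flat k has_real_derivative 0) (at 0)"
      by (simp add: DERIV_def)
    with 2 show ?thesis by (simp add: flat_def)
  next
    case 3
    have "(flat k has_real_derivative
        (exp (- 1 / t) / t ^ (k + 2) - real k * (exp (- 1 / t) / t ^ (k + 1)))) (at t)"
    proof (rule has_field_derivative_transform_within_open[where S = "{0<..}"])
      show "((\<lambda>x. exp (- 1 / x) / x ^ k) has_real_derivative
        (exp (- 1 / t) / t ^ (k + 2) - real k * (exp (- 1 / t) / t ^ (k + 1)))) (at t)"
      proof -
        have "((\<lambda>x. exp (- 1 / x) / x ^ k) has_real_derivative
            (exp (- 1 / t) / t\<^sup>2 * t ^ k - exp (- 1 / t) * (real k * t ^ (k - 1))) / (t ^ k * t ^ k)) (at t)"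
          using 3 by (auto intro!: derivative_eq_intros simp: power2_eq_square)
        also have "(exp (- 1 / t) / t\<^sup>2 * t ^ k - exp (- 1 / t) * (real k * t ^ (k - 1))) / (t ^ k * t ^ k) =
            exp (- 1 / t) / t ^ (k + 2) - real k * (exp (- 1 / t) / t ^ (k + 1))"
          using 3 by (cases k) (simp_all add: field_simps power2_eq_square)
        finally show ?thesis .
      qed
    qed (use 3 in \<open>auto simp: flat_def\<close>)
    with 3 show ?thesis by (simp add: flat_def)
  qed
qed

lemma dir_deriv_eqI:
  assumes "(f has_derivative f') (at x)"
  shows "dir_deriv v f x = f' v"
  using frechet_derivative_at[OF assms] by (simp add: dir_deriv_def)

lemma dir_deriv_add:
  assumes "f differentiable at x" "g differentiable at x"
  shows "dir_deriv v (\<lambda>y. f y + g y) x = dir_deriv v f x + dir_deriv v g x"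
proof -
  have "((\<lambda>y. f y + g y) has_derivative
      (\<lambda>h. frechet_derivative f (at x) h + frechet_derivative g (at x) h)) (at x)"
    using assms by (intro has_derivative_add) (simp_all add: frechet_derivative_works)
  from dir_deriv_eqI[OF this] show ?thesis by (simp add: dir_deriv_def)
qed

lemma dir_deriv_mult:
  assumes "f differentiable at x" "g differentiable at x"
  shows "dir_deriv v (\<lambda>y. f y * g y) x = dir_deriv v f x * g x + f x * dir_deriv v g x"
proof -
  have "((\<lambda>y. f y * g y) has_derivative
      (\<lambda>h. f x * frechet_derivative g (at x) h + frechet_derivative f (at x) h * g x)) (at x)"
    using assms by (intro has_derivative_mult) (simp_all add: frechet_derivative_works)
  from dir_deriv_eqI[OF this] show ?thesis by (simp add: dir_deriv_def)
qed

text \<open>The algebra generated by the polynomials and the functions \<open>flat k\<close> of \<open>R\<^sup>2 - \<bar>x - c\<bar>\<^sup>2\<close>.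
  It is closed under directional derivatives, so that smoothness of its members, a statement about
  all iterated derivatives, needs only one induction.\<close>

inductive bump_algebra :: "'a::euclidean_space \<Rightarrow> real \<Rightarrow> ('a \<Rightarrow> real) \<Rightarrow> bool" for c R where
  linear: "bounded_linear f \<Longrightarrow> bump_algebra c R f"
| const: "bump_algebra c R (\<lambda>x. a)"
| flat: "bump_algebra c R (\<lambda>x. flat k (R\<^sup>2 - (x - c) \<bullet> (x - c)))"
| add: "bump_algebra c R f \<Longrightarrow> bump_algebra c R g \<Longrightarrow> bump_algebra c R (\<lambda>x. f x + g x)"
| mult: "bump_algebra c R f \<Longrightarrow> bump_algebra c R g \<Longrightarrow> bump_algebra c R (\<lambda>x. f x * g x)"

lemma bump_algebra_polynomial: "real_polynomial_function p \<Longrightarrow> bump_algebra c R p"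
  by (induction rule: real_polynomial_function.induct) (auto intro: bump_algebra.intros)

lemma bump_algebra_deriv:
  assumes "bump_algebra c R f"
  shows "(\<forall>x. f differentiable at x) \<and> bump_algebra c R (dir_deriv v f)"
  using assms
proof induction
  case (linear f)
  have "dir_deriv v f = (\<lambda>x. f v)"
    by (rule ext, rule dir_deriv_eqI) (rule bounded_linear_imp_has_derivative[OF linear])
  then show ?case
    using bounded_linear_imp_differentiable[OF linear] by (auto intro: bump_algebra.const)
next
  case (const a)
  have "dir_deriv v (\<lambda>x::'a. a) = (\<lambda>x. 0)"
    by (rule ext, rule dir_deriv_eqI[where f' = "\<lambda>x. 0"]) simp
  then show ?case by (auto intro: bump_algebra.const)
next
  case (flat k)
  let ?q = "\<lambda>x. R\<^sup>2 - (x - c) \<bullet> (x - c)"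
  have D: "((\<lambda>x. flat k (?q x)) has_derivative
      (\<lambda>h. (flat (k + 2) (?q x) - real k * flat (k + 1) (?q x)) * (- 2 * ((x - c) \<bullet> h)))) (at x)" for x
  proof -
    have "(?q has_derivative (\<lambda>h. - 2 * ((x - c) \<bullet> h))) (at x)"
      by (auto intro!: derivative_eq_intros simp: inner_commute algebra_simps)
    from has_derivative_compose[OF this flat_has_derivative[unfolded has_field_derivative_def]]
    show ?thesis by simp
  qed
  have "dir_deriv v (\<lambda>x. flat k (?q x)) =
      (\<lambda>x. (flat (k + 2) (?q x) + (- real k) * flat (k + 1) (?q x)) * (- 2 * ((v \<bullet> x) + - (v \<bullet> c))))"
    by (rule ext, rule trans[OF dir_deriv_eqI[OF D]]) (simp add: inner_diff_right inner_commute algebra_simps)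
  moreover have "bump_algebra c R (\<lambda>x. (flat (k + 2) (?q x) + (- real k) * flat (k + 1) (?q x)) *
      (- 2 * ((v \<bullet> x) + - (v \<bullet> c))))"
    by (intro bump_algebra.mult bump_algebra.add bump_algebra.flat bump_algebra.const
        bump_algebra.linear bounded_linear_inner_right)
  ultimately have "bump_algebra c R (dir_deriv v (\<lambda>x. flat k (?q x)))" by simp
  then show ?case using D by (auto simp: differentiable_def)
next
  case (add f g)
  have "dir_deriv v (\<lambda>x. f x + g x) = (\<lambda>x. dir_deriv v f x + dir_deriv v g x)"
    using add.IH by (intro ext dir_deriv_add) auto
  then show ?case using add by (auto intro: bump_algebra.add)
next
  case (mult f g)
  have "dir_deriv v (\<lambda>x. f x * g x) = (\<lambda>x. dir_deriv v f x * g x + f x * dir_deriv v g x)"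
    using mult.IH by (intro ext dir_deriv_mult) auto
  then show ?case using mult by (auto intro: bump_algebra.add bump_algebra.mult)
qed

lemma bump_algebra_smooth:
  assumes "bump_algebra c R f"
  shows "smooth_on UNIV f"
proof -
  have it: "bump_algebra c R (iter_deriv vs f)" for vs
    by (induction vs) (use assms bump_algebra_deriv in auto)
  have d: "iter_deriv vs f differentiable (at x)" for vs x
    using bump_algebra_deriv[OF it] by blast
  have "continuous_on UNIV (iter_deriv vs f)" for vs
    unfolding continuous_on_eq_continuous_within
    using d differentiable_imp_continuous_within by blast
  with d show ?thesis by (auto simp: smooth_on_def Ck_on_def)
qed

definition bump :: "'a::euclidean_space \<Rightarrow> real \<Rightarrow> 'a \<Rightarrow> real" where
  "bump c R x = flat 0 (R\<^sup>2 - (x - c) \<bullet> (x - c))"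

lemma bump_nonneg: "bump c R x \<ge> 0"
  by (simp add: bump_def flat_nonneg)

lemma bump_pos_iff:
  assumes "R > 0"
  shows "bump c R x > 0 \<longleftrightarrow> x \<in> ball c R"
proof -
  have "x \<in> ball c R \<longleftrightarrow> (x - c) \<bullet> (x - c) < R\<^sup>2"
  proof -
    have "x \<in> ball c R \<longleftrightarrow> norm (x - c) < R"
      by (simp add: dist_norm norm_minus_commute)
    also have "\<dots> \<longleftrightarrow> (norm (x - c))\<^sup>2 < R\<^sup>2"
      using assms by (metis abs_of_pos abs_norm_cancel power2_less_imp_less power_strict_mono norm_ge_zero order_less_le zero_less_numeral)
    finally show ?thesis by (simp add: power2_norm_eq_inner)
  qed
  then show ?thesis
    unfolding bump_def using flat_pos[of "R\<^sup>2 - (x - c) \<bullet> (x - c)" 0]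
      flat_eq_0[of "R\<^sup>2 - (x - c) \<bullet> (x - c)" 0] by fastforce
qed

lemma bump_eq_0: "R > 0 \<Longrightarrow> x \<notin> ball c R \<Longrightarrow> bump c R x = 0"
  using bump_pos_iff[of R c x] bump_nonneg[of c R x] by linarith

lemma bump_in_bump_algebra: "bump_algebra c R (bump c R)"
  unfolding bump_def by (rule bump_algebra.flat)

section \<open>Test functions and weighted approximation\<close>

lemma supp_subset:
  assumes "closed K" "\<And>x. x \<notin> K \<Longrightarrow> f x = 0"
  shows "supp f \<subseteq> K"
  by (rule closure_minimal) (use assms in \<open>auto simp: support_on_def\<close>)

lemma eq_0_outside_supp: "x \<notin> supp f \<Longrightarrow> f x = 0"
  using closure_subset[of "support_on UNIV f"] by (auto simp: support_on_def)

lemma test_functionsI: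
  assumes "smooth_on UNIV f" "compact K" "\<And>x. x \<notin> K \<Longrightarrow> f x = 0"
  shows "f \<in> test_functions UNIV"
proof -
  have "supp f \<subseteq> K" using assms by (intro supp_subset) (auto simp: compact_imp_closed)
  then have "compact (supp f)"
    using assms(2) by (meson bounded_subset closed_closure compact_eq_bounded_closed)
  with assms show ?thesis by (simp add: test_functions_def)
qed

lemma bump_times_bump_algebra_test:
  assumes "R > 0" "bump_algebra c R p"
  shows "(\<lambda>x. bump c R x * p x) \<in> test_functions UNIV"
proof (rule test_functionsI)
  show "smooth_on UNIV (\<lambda>x. bump c R x * p x)"
    by (rule bump_algebra_smooth[OF bump_algebra.mult[OF bump_in_bump_algebra assms(2)]])
  show "compact (cball c R)" by simp
  show "bump c R x * p x = 0" if "x \<notin> cball c R" for x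
    using that assms(1) bump_eq_0[of R x c] by simp
qed

lemma bump_test: "R > 0 \<Longrightarrow> bump c R \<in> test_functions UNIV"
  using bump_times_bump_algebra_test[of R c "\<lambda>_. 1"] by (simp add: bump_algebra.const)

lemma test_functions_smooth: "\<phi> \<in> test_functions S \<Longrightarrow> smooth_on UNIV \<phi>"
  by (simp add: test_functions_def)

lemma test_functions_compact_supp: "\<phi> \<in> test_functions S \<Longrightarrow> compact (supp \<phi>)"
  by (simp add: test_functions_def)

lemma smooth_on_imp_Ck_on: "smooth_on S f \<Longrightarrow> Ck_on k S f"
  by (simp add: smooth_on_def)

lemma Ck_on_imp_continuous_on: "Ck_on k S f \<Longrightarrow> continuous_on S f"
  unfolding Ck_on_def by (metis empty_subsetI iter_deriv.simps(1) list.set(1) list.size(3) zero_le)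

lemma smooth_on_imp_continuous_on: "smooth_on S f \<Longrightarrow> continuous_on S f"
  using Ck_on_imp_continuous_on smooth_on_imp_Ck_on by blast

lemma bump_continuous: "continuous_on UNIV (bump c R)"
  by (rule smooth_on_imp_continuous_on[OF bump_algebra_smooth[OF bump_in_bump_algebra]])

text \<open>A polynomial that is \<open>\<epsilon>\<close>-close to \<open>f / bump c R\<close> on the closed ball, multiplied by the bump,
  is a test function whose distance from \<open>f\<close> is at most \<open>\<epsilon>\<close> times the bump. The error bound is
  weighted by a test function, which lets it pass through every positive operator below.\<close>

lemma test_approximation:
  fixes f :: "'a::euclidean_space \<Rightarrow> real"
  assumes f: "continuous_on UNIV f" and K: "closed K" "K \<subseteq> ball c R"
    and f0: "\<And>x. x \<notin> K \<Longrightarrow> f x = 0" and R: "R > 0" and e: "\<epsilon> > 0"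
  obtains \<phi> where "\<phi> \<in> test_functions UNIV" "\<And>x. \<bar>f x - \<phi> x\<bar> \<le> \<epsilon> * bump c R x"
proof -
  define q where "q x = f x / bump c R x" for x
  have nz: "bump c R x \<noteq> 0" if "x \<in> ball c R" for x
    using bump_pos_iff[OF R, of c x] that by simp
  have "continuous_on (ball c R \<union> - K) q"
  proof (rule continuous_on_open_Un)
    show "continuous_on (ball c R) q"
      unfolding q_def using nz
      by (intro continuous_on_divide continuous_on_subset[OF f] continuous_on_subset[OF bump_continuous]) auto
    have "continuous_on (- K) (\<lambda>x. 0::real)" by simp
    then show "continuous_on (- K) q"
      by (rule continuous_on_eq) (simp add: q_def f0)
  qed (use K in auto)
  moreover have "ball c R \<union> - K = UNIV" using K by auto
  ultimately have q: "continuous_on (cball c R) q"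
    using continuous_on_subset by (metis subset_UNIV)
  obtain p where p: "real_polynomial_function p" "\<And>x. x \<in> cball c R \<Longrightarrow> \<bar>q x - p x\<bar> < \<epsilon>"
    using Stone_Weierstrass_real_polynomial_function[OF compact_cball q e] by metis
  show ?thesis
  proof
    show "(\<lambda>x. bump c R x * p x) \<in> test_functions UNIV"
      by (rule bump_times_bump_algebra_test[OF R bump_algebra_polynomial[OF p(1)]])
    show "\<bar>f x - bump c R x * p x\<bar> \<le> \<epsilon> * bump c R x" for x
    proof (cases "x \<in> ball c R")
      case True
      then have "f x - bump c R x * p x = bump c R x * (q x - p x)"
        using nz by (simp add: q_def field_simps)
      then have "\<bar>f x - bump c R x * p x\<bar> = bump c R x * \<bar>q x - p x\<bar>"
        by (simp add: abs_mult bump_nonneg)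
      also have "\<dots> \<le> bump c R x * \<epsilon>"
        using p(2)[of x] True by (intro mult_left_mono) (auto simp: bump_nonneg)
      finally show ?thesis by (simp add: mult.commute)
    next
      case False
      then have "f x = 0" "bump c R x = 0"
        using f0[of x] K(2) bump_eq_0[OF R] by blast+
      then show ?thesis by simp
    qed
  qed
qed

lemma open_not_null_sets_lborel:
  fixes U :: "'a::euclidean_space set"
  assumes "open U" "U \<noteq> {}"
  shows "U \<notin> null_sets lborel"
  using open_not_negligible[OF assms] by (auto simp: negligible_iff_null_sets null_sets_completionI)

lemma integrable_continuous_compact_support:
  fixes f :: "'a::euclidean_space \<Rightarrow> real"
  assumes "continuous_on UNIV f" "compact K" "\<And>x. x \<notin> K \<Longrightarrow> f x = 0"
  shows "integrable lborel f"
proof -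
  have "set_integrable lborel K f"
    unfolding set_integrable_def
    by (rule borel_integrable_compact[OF assms(2) continuous_on_subset[OF assms(1)]]) simp
  moreover have "(\<lambda>x. indicator K x *\<^sub>R f x) = f"
    using assms(3) by (fastforce simp: indicator_def)
  ultimately show ?thesis by (simp add: set_integrable_def)
qed

text \<open>A continuous function that is positive at \<open>a\<close> is positive on a ball, and a bump supported in
  that ball detects it.\<close>

lemma du_Bois_Reymond_le:
  fixes d :: "'a::euclidean_space \<Rightarrow> real"
  assumes d: "continuous_on UNIV d"
    and z: "\<And>\<phi>. \<phi> \<in> test_functions UNIV \<Longrightarrow> (LINT x|lborel. d x * \<phi> x) = 0"
  shows "d a \<le> 0"
proof (rule ccontr)
  assume "\<not> d a \<le> 0"
  then have "open {x. d x > 0}" "a \<in> {x. d x > 0}"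
    using open_Collect_less[OF continuous_on_const d, of 0] by auto
  then obtain e where e: "e > 0" "ball a e \<subseteq> {x. d x > 0}"
    using open_contains_ball by blast
  let ?g = "\<lambda>x. d x * bump a e x"
  have "integrable lborel ?g"
  proof (rule integrable_continuous_compact_support)
    show "continuous_on UNIV ?g"
      by (intro continuous_intros d bump_continuous)
    show "?g x = 0" if "x \<notin> cball a e" for x
      using that bump_eq_0[OF e(1), of x a] by simp
  qed simp
  moreover have "?g x \<ge> 0" for x
    using e(2) bump_nonneg[of a e x] bump_eq_0[OF e(1), of x a] by (cases "x \<in> ball a e") (auto simp: subset_iff less_imp_le)
  ultimately have "AE x in lborel. ?g x = 0"
    using integral_nonneg_eq_0_iff_AE[of lborel ?g] z[OF bump_test[OF e(1)]] by simp
  moreover have "x \<notin> ball a e" if "?g x = 0" for x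
    using that e(2) bump_pos_iff[OF e(1), of a x] by (auto simp: subset_iff)
  ultimately have "AE x in lborel. x \<notin> ball a e"
    by (auto elim: eventually_mono)
  then have "ball a e \<in> null_sets lborel"
    by (simp add: AE_iff_null_sets)
  then show False using open_not_null_sets_lborel[of "ball a e"] e(1) by simp
qed

lemma du_Bois_Reymond:
  fixes d :: "'a::euclidean_space \<Rightarrow> real"
  assumes d: "continuous_on UNIV d"
    and z: "\<And>\<phi>. \<phi> \<in> test_functions UNIV \<Longrightarrow> (LINT x|lborel. d x * \<phi> x) = 0"
  shows "d a = 0"
proof -
  have "- d a \<le> 0"
    using assms by (intro du_Bois_Reymond_le[where d = "\<lambda>x. - d x"]) (auto intro: continuous_intros)
  with du_Bois_Reymond_le[OF assms, of a] show ?thesis by linarith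
qed

section \<open>Integration by parts\<close>

lemma dir_deriv_eq_0_outside:
  assumes "closed K" "\<And>y. y \<notin> K \<Longrightarrow> f y = 0" "x \<notin> K"
  shows "dir_deriv v f x = 0"
proof (rule dir_deriv_eqI[where f' = "\<lambda>_. 0"])
  show "(f has_derivative (\<lambda>_. 0)) (at x)"
    by (rule has_derivative_transform_within_open[where s = "- K" and f = "\<lambda>_. 0"])
      (use assms in auto)
qed

lemma has_real_derivative_along_line:
  assumes "f differentiable at (x + t *\<^sub>R v)"
  shows "((\<lambda>s. f (x + s *\<^sub>R v)) has_real_derivative dir_deriv v f (x + t *\<^sub>R v)) (at t)"
proof -
  have "((\<lambda>s. x + s *\<^sub>R v) has_derivative (\<lambda>s. s *\<^sub>R v)) (at t)"
    by (auto intro!: derivative_eq_intros)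
  moreover have D: "(f has_derivative frechet_derivative f (at (x + t *\<^sub>R v))) (at (x + t *\<^sub>R v))"
    using assms by (simp add: frechet_derivative_works)
  ultimately have "((\<lambda>s. f (x + s *\<^sub>R v)) has_derivative
      (\<lambda>s. frechet_derivative f (at (x + t *\<^sub>R v)) (s *\<^sub>R v))) (at t)"
    by (rule has_derivative_compose)
  moreover have "(\<lambda>s. frechet_derivative f (at (x + t *\<^sub>R v)) (s *\<^sub>R v)) =
      (*) (dir_deriv v f (x + t *\<^sub>R v))"
    using linear_cmul[OF has_derivative_linear[OF D]] by (auto simp: dir_deriv_def)
  ultimately show ?thesis
    by (simp add: has_field_derivative_def)
qed

lemma bounded_of_compact_support:
  fixes f :: "'a::euclidean_space \<Rightarrow> real"
  assumes "continuous_on UNIV f" "compact K" "\<And>x. x \<notin> K \<Longrightarrow> f x = 0"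
  obtains B where "B \<ge> 0" "\<And>x. \<bar>f x\<bar> \<le> B"
proof -
  have "bounded (f ` K)"
    using assms by (intro compact_imp_bounded compact_continuous_image continuous_on_subset[OF assms(1)]) auto
  then obtain B where "\<forall>x\<in>K. \<bar>f x\<bar> \<le> B" by (auto simp: bounded_iff)
  then have "\<bar>f x\<bar> \<le> \<bar>B\<bar>" for x using assms(3)[of x] by (cases "x \<in> K") force+
  then show ?thesis using that[of "\<bar>B\<bar>"] by simp
qed

lemma lborel_integral_translate:
  fixes f :: "'a::euclidean_space \<Rightarrow> real"
  assumes [measurable]: "f \<in> borel_measurable borel"
  shows "(LINT x|lborel. f (a + x)) = (LINT x|lborel. f x)"
proof -
  have "(LINT x|lborel. f x) = (LINT x|distr lborel borel ((+) a). f x)"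
    by (simp add: lborel_distr_plus)
  also have "\<dots> = (LINT x|lborel. f (a + x))"
    by (rule integral_distr) measurable
  finally show ?thesis by simp
qed

text \<open>By translation invariance the difference quotients of \<open>h\<close> in direction \<open>v\<close> have integral \<open>0\<close>.
  The mean value theorem bounds them uniformly, and their supports lie in one ball, so dominated
  convergence carries this over to the derivative.\<close>

lemma integral_dir_deriv_eq_0:
  fixes h :: "'a::euclidean_space \<Rightarrow> real"
  assumes diff: "\<And>x. h differentiable at x" and cont: "continuous_on UNIV (dir_deriv v h)"
    and K: "compact K" "\<And>x. x \<notin> K \<Longrightarrow> h x = 0"
  shows "(LINT x|lborel. dir_deriv v h x) = 0"
proof -
  have h_cont: "continuous_on UNIV h"
    unfolding continuous_on_eq_continuous_within
    using diff differentiable_imp_continuous_within by blast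
  then have [measurable]: "h \<in> borel_measurable borel"
    by (rule borel_measurable_continuous_onI)
  have g0: "dir_deriv v h x = 0" if "x \<notin> K" for x
    using dir_deriv_eq_0_outside K that compact_imp_closed by blast
  obtain B where B: "B \<ge> 0" "\<And>x. \<bar>dir_deriv v h x\<bar> \<le> B"
    using bounded_of_compact_support[OF cont K(1) g0] by blast
  obtain \<rho> where \<rho>: "K \<subseteq> cball 0 \<rho>"
    using compact_imp_bounded[OF K(1)] by (auto simp: bounded_iff subset_iff)
  define t where "t n = inverse (real (Suc n))" for n
  have t: "0 < t n" "t n \<le> 1" for n by (auto simp: t_def field_simps)
  define s where "s n x = (h (t n *\<^sub>R v + x) - h x) / t n" for n x
  have int_h: "integrable lborel h"
    by (rule integrable_continuous_compact_support[OF h_cont K])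
  have "(LINT x|lborel. s n x) = 0" for n
  proof -
    have "integrable lborel (\<lambda>x. h (t n *\<^sub>R v + x))"
    proof (rule integrable_continuous_compact_support[where K = "(\<lambda>x. - (t n *\<^sub>R v) + x) ` K"])
      show "continuous_on UNIV (\<lambda>x. h (t n *\<^sub>R v + x))"
        by (rule continuous_on_compose2[OF h_cont]) (auto intro!: continuous_intros)
      show "compact ((\<lambda>x. - (t n *\<^sub>R v) + x) ` K)"
        by (rule compact_translation[OF K(1)])
      show "h (t n *\<^sub>R v + x) = 0" if "x \<notin> (\<lambda>x. - (t n *\<^sub>R v) + x) ` K" for x
        by (rule K(2)) (use that in \<open>force simp: image_iff\<close>)
    qed
    then show ?thesis
      unfolding s_def using int_h by (simp add: lborel_integral_translate)
  qed
  moreover have "(\<lambda>n. LINT x|lborel. s n x) \<longlonglongrightarrow> (LINT x|lborel. dir_deriv v h x)"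
  proof (rule integral_dominated_convergence)
    show "dir_deriv v h \<in> borel_measurable lborel"
      using borel_measurable_continuous_onI[OF cont] by simp
    show "s n \<in> borel_measurable lborel" for n unfolding s_def by measurable
    \<comment> \<open>The radius allows for steps of length at most \<open>norm v\<close>, since \<open>t n \<le> 1\<close>.\<close>
    show "integrable lborel (\<lambda>x. B * indicator (cball 0 (\<rho> + norm v)) x)"
      using emeasure_lborel_cball_finite by (intro integrable_mult_right integrable_real_indicator) (simp_all add: top.not_eq_extremum less_top)
    show "AE x in lborel. (\<lambda>n. s n x) \<longlonglongrightarrow> dir_deriv v h x"
    proof (rule AE_I2)
      fix x
      have "((\<lambda>a. (h (x + a *\<^sub>R v) - h x) / a) \<longlongrightarrow> dir_deriv v h x) (at 0)"
        using has_real_derivative_along_line[of h x 0 v] diff by (simp add: DERIV_def)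
      moreover have "filterlim t (at 0) sequentially"
        unfolding filterlim_at using t LIMSEQ_inverse_real_of_nat
        by (auto simp: t_def[abs_def] intro!: always_eventually)
      ultimately have "(\<lambda>n. (h (x + t n *\<^sub>R v) - h x) / t n) \<longlonglongrightarrow> dir_deriv v h x"
        by (rule filterlim_compose)
      then show "(\<lambda>n. s n x) \<longlonglongrightarrow> dir_deriv v h x"
        by (simp add: s_def add.commute)
    qed
    show "AE x in lborel. norm (s n x) \<le> B * indicator (cball 0 (\<rho> + norm v)) x" for n
    proof (rule AE_I2)
      fix x
      show "norm (s n x) \<le> B * indicator (cball 0 (\<rho> + norm v)) x"
      proof (cases "x \<in> cball 0 (\<rho> + norm v)")
        case True
        obtain z where "h (x + t n *\<^sub>R v) - h (x + 0 *\<^sub>R v) = (t n - 0) * dir_deriv v h (x + z *\<^sub>R v)"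
          using MVT2[OF t(1)[of n], where f = "\<lambda>a. h (x + a *\<^sub>R v)" and f' = "\<lambda>a. dir_deriv v h (x + a *\<^sub>R v)"]
            has_real_derivative_along_line diff by blast
        then have "s n x = dir_deriv v h (x + z *\<^sub>R v)"
          using t(1)[of n] by (simp add: s_def add.commute)
        with True B show ?thesis by simp
      next
        case False
        have "norm x \<le> norm (t n *\<^sub>R v + x) + norm (t n *\<^sub>R v)"
          using norm_triangle_ineq4[of "t n *\<^sub>R v + x" "t n *\<^sub>R v"] by simp
        moreover have "norm (t n *\<^sub>R v) \<le> norm v"
          using t[of n] by (simp add: mult_left_le_one_le)
        ultimately have "x \<notin> cball 0 \<rho>" "t n *\<^sub>R v + x \<notin> cball 0 \<rho>"
          using False by auto (smt (verit) norm_ge_zero)+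
        then have "h x = 0" "h (t n *\<^sub>R v + x) = 0" using \<rho> K(2) by blast+
        then show ?thesis using B(1) by (simp add: s_def)
      qed
    qed
  qed
  ultimately show ?thesis by (simp add: LIMSEQ_const_iff)
qed

lemma Ck_on_dir_deriv:
  assumes "Ck_on (Suc k) S f" "v \<in> Basis"
  shows "Ck_on k S (dir_deriv v f)"
proof -
  have it: "iter_deriv vs (dir_deriv v f) = iter_deriv (vs @ [v]) f" for vs
    by (induction vs) auto
  show ?thesis
    unfolding Ck_on_def it
  proof (intro conjI allI impI)
    fix vs :: "'a list"
    show "continuous_on S (iter_deriv (vs @ [v]) f)" if "set vs \<subseteq> Basis \<and> length vs \<le> k"
      using assms(1)[unfolded Ck_on_def, THEN conjunct1, rule_format, of "vs @ [v]"] that assms(2) by simp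
    show "\<forall>x\<in>S. iter_deriv (vs @ [v]) f differentiable at x" if "set vs \<subseteq> Basis \<and> length vs < k"
      using assms(1)[unfolded Ck_on_def, THEN conjunct2, rule_format, of "vs @ [v]"] that assms(2) by simp
  qed
qed

lemma Ck_on_Suc_imp: "Ck_on (Suc k) S f \<Longrightarrow> Ck_on k S f"
  by (auto simp: Ck_on_def)

lemma Ck_on_1_iff:
  "Ck_on 1 UNIV f \<longleftrightarrow>
    (\<forall>x. f differentiable at x) \<and> (\<forall>v\<in>Basis. continuous_on UNIV (dir_deriv v f))"
proof
  assume *: "Ck_on 1 UNIV f"
  have "f differentiable at x" for x
    using *[unfolded Ck_on_def, THEN conjunct2, rule_format, of "[]"] by simp
  moreover have "continuous_on UNIV (dir_deriv v f)" if "v \<in> Basis" for v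
    using *[unfolded Ck_on_def, THEN conjunct1, rule_format, of "[v]"] that by simp
  ultimately show "(\<forall>x. f differentiable at x) \<and> (\<forall>v\<in>Basis. continuous_on UNIV (dir_deriv v f))"
    by blast
next
  assume *: "(\<forall>x. f differentiable at x) \<and> (\<forall>v\<in>Basis. continuous_on UNIV (dir_deriv v f))"
  then have "continuous_on UNIV f"
    unfolding continuous_on_eq_continuous_within
    using differentiable_imp_continuous_within by blast
  with * show "Ck_on 1 UNIV f"
    by (auto simp: Ck_on_def le_Suc_eq length_Suc_conv)
qed

lemma Ck_on_1_differentiable: "Ck_on 1 UNIV f \<Longrightarrow> f differentiable at x"
  using Ck_on_1_iff by blast

lemma Ck_on_1_dir_deriv_continuous:
  "Ck_on 1 UNIV f \<Longrightarrow> v \<in> Basis \<Longrightarrow> continuous_on UNIV (dir_deriv v f)"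
  using Ck_on_1_iff by blast

lemma Ck_on_1_mult:
  assumes "Ck_on 1 UNIV f" "Ck_on 1 UNIV g"
  shows "Ck_on 1 UNIV (\<lambda>x. f x * g x)"
proof -
  have "dir_deriv v (\<lambda>x. f x * g x) = (\<lambda>x. dir_deriv v f x * g x + f x * dir_deriv v g x)" for v
    using assms by (intro ext dir_deriv_mult Ck_on_1_differentiable)
  moreover have "continuous_on UNIV (\<lambda>x. dir_deriv v f x * g x + f x * dir_deriv v g x)" if "v \<in> Basis" for v
    using that assms by (intro continuous_intros Ck_on_1_dir_deriv_continuous Ck_on_imp_continuous_on)
  ultimately show ?thesis
    unfolding Ck_on_1_iff using assms by (simp add: Ck_on_1_differentiable)
qed

lemma integral_by_parts:
  assumes f: "Ck_on 1 UNIV f" and g: "Ck_on 1 UNIV g" and v: "v \<in> Basis"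
    and K: "compact K" "\<And>x. x \<notin> K \<Longrightarrow> g x = 0"
  shows "(LINT x|lborel. f x * dir_deriv v g x) = - (LINT x|lborel. dir_deriv v f x * g x)"
proof -
  note cont = Ck_on_imp_continuous_on[OF f] Ck_on_imp_continuous_on[OF g]
  have fg: "Ck_on 1 UNIV (\<lambda>x. f x * g x)" by (rule Ck_on_1_mult[OF f g])
  have "dir_deriv v (\<lambda>x. f x * g x) = (\<lambda>x. dir_deriv v f x * g x + f x * dir_deriv v g x)"
    using f g by (intro ext dir_deriv_mult Ck_on_1_differentiable)
  moreover have "(LINT x|lborel. dir_deriv v (\<lambda>x. f x * g x) x) = 0"
    using K by (intro integral_dir_deriv_eq_0[where K = K] Ck_on_1_differentiable[OF fg]
        Ck_on_1_dir_deriv_continuous[OF fg v]) auto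
  moreover have "integrable lborel (\<lambda>x. dir_deriv v f x * g x)"
    using K by (intro integrable_continuous_compact_support[where K = K] continuous_intros cont
        Ck_on_1_dir_deriv_continuous[OF f v]) auto
  moreover have "dir_deriv v g x = 0" if "x \<notin> K" for x
    using dir_deriv_eq_0_outside K that compact_imp_closed by blast
  then have "integrable lborel (\<lambda>x. f x * dir_deriv v g x)"
    by (intro integrable_continuous_compact_support[OF _ K(1)] continuous_intros cont
        Ck_on_1_dir_deriv_continuous[OF g v]) auto
  ultimately show ?thesis by simp
qed

lemma axis_Basis [simp]: "axis i (1::real) \<in> Basis"
  by (simp add: axis_in_Basis_iff)

lemma Ck_on_2_partial: "Ck_on 2 UNIV f \<Longrightarrow> Ck_on 1 UNIV (partial i f)"
  by (rule Ck_on_dir_deriv) (simp_all add: numeral_2_eq_2)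

lemma Ck_on_2_imp_1: "Ck_on 2 UNIV f \<Longrightarrow> Ck_on 1 UNIV f"
  using Ck_on_Suc_imp[of 1] by (simp add: numeral_2_eq_2)

section \<open>Green's identity\<close>

locale smooth_coefficients =
  fixes A :: "real^'n \<Rightarrow> real^'n^'n" and b :: "real^'n \<Rightarrow> real^'n"
  assumes A_smooth: "\<And>i j. smooth_on UNIV (\<lambda>x. A x $ i $ j)"
    and b_smooth: "\<And>i. smooth_on UNIV (\<lambda>x. b x $ i)"
begin

lemma second_order_term_C1: "Ck_on 2 UNIV f \<Longrightarrow> Ck_on 1 UNIV (\<lambda>z. A z $ i $ j * partial k f z)"
  by (rule Ck_on_1_mult[OF smooth_on_imp_Ck_on[OF A_smooth] Ck_on_2_partial])

lemma first_order_term_C1: "Ck_on 1 UNIV f \<Longrightarrow> Ck_on 1 UNIV (\<lambda>z. b z $ i * f z)"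
  by (rule Ck_on_1_mult[OF smooth_on_imp_Ck_on[OF b_smooth]])

lemma partial_continuous: "Ck_on 1 UNIV f \<Longrightarrow> continuous_on UNIV (partial i f)"
  by (rule Ck_on_1_dir_deriv_continuous) simp_all

lemma L_op_continuous:
  assumes "Ck_on 2 UNIV f"
  shows "continuous_on UNIV (L_op A b f)"
  unfolding L_op_def
  by (intro continuous_intros partial_continuous second_order_term_C1 assms Ck_on_2_imp_1
      smooth_on_imp_continuous_on[OF b_smooth])

lemma L_adj_continuous:
  assumes "Ck_on 2 UNIV f"
  shows "continuous_on UNIV (L_adj A b f)"
  unfolding L_adj_def
  by (intro continuous_intros partial_continuous second_order_term_C1 first_order_term_C1
      assms Ck_on_2_imp_1)

lemma L_adj_eq_0_outside:
  assumes "closed K" "\<And>y. y \<notin> K \<Longrightarrow> \<phi> y = 0" "x \<notin> K"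
  shows "L_adj A b \<phi> x = 0"
proof -
  have "partial j \<phi> y = 0" if "y \<notin> K" for y j
    by (rule dir_deriv_eq_0_outside[OF assms(1,2) that])
  then have "partial i (\<lambda>z. A z $ i $ j * partial j \<phi> z) x = 0" for i j
    by (intro dir_deriv_eq_0_outside[OF assms(1) _ assms(3)]) simp
  moreover have "partial i (\<lambda>z. b z $ i * \<phi> z) x = 0" for i
    by (intro dir_deriv_eq_0_outside[OF assms(1) _ assms(3)]) (simp add: assms(2))
  ultimately show ?thesis by (simp add: L_adj_def)
qed

text \<open>Two integrations by parts for the second-order terms, where the symmetry of \<open>A\<close> restores the
  original order of the indices, and one for the first-order terms.\<close>

lemma Green_identity:
  assumes sym: "\<And>x. transpose (A x) = A x"
    and V: "Ck_on 2 UNIV V" and \<phi>: "\<phi> \<in> test_functions UNIV"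
  shows "(LINT x|lborel. V x * L_adj A b \<phi> x) = (LINT x|lborel. L_op A b V x * \<phi> x)"
proof -
  define K where "K = supp \<phi>"
  have K: "compact K" unfolding K_def by (rule test_functions_compact_supp[OF \<phi>])
  have \<phi>0: "\<phi> x = 0" if "x \<notin> K" for x using that eq_0_outside_supp K_def by blast
  have d\<phi>0: "partial j \<phi> y = 0" if "y \<notin> K" for y j
    by (rule dir_deriv_eq_0_outside[OF compact_imp_closed[OF K] \<phi>0 that])
  have C: "Ck_on k UNIV \<phi>" for k
    using \<phi> test_functions_smooth smooth_on_imp_Ck_on by blast
  note C1 = Ck_on_2_imp_1[OF V] Ck_on_2_imp_1[OF C] Ck_on_2_partial[OF V] Ck_on_2_partial[OF C]
    second_order_term_C1[OF V] second_order_term_C1[OF C] first_order_term_C1[OF Ck_on_2_imp_1[OF C]]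
  note cont = C1[THEN Ck_on_imp_continuous_on] C1[THEN partial_continuous]
    smooth_on_imp_continuous_on[OF A_smooth] smooth_on_imp_continuous_on[OF b_smooth]
  note int = integrable_continuous_compact_support[OF _ K]
  have A_sym: "A x $ i $ j = A x $ j $ i" for x i j
    using sym[of x] by (metis transpose_def vec_lambda_beta)
  have 2: "(LINT x|lborel. V x * partial i (\<lambda>z. A z $ i $ j * partial j \<phi> z) x) =
      (LINT x|lborel. partial j (\<lambda>z. A z $ j $ i * partial i V z) x * \<phi> x)" for i j
  proof -
    have "(LINT x|lborel. V x * partial i (\<lambda>z. A z $ i $ j * partial j \<phi> z) x) =
        - (LINT x|lborel. partial i V x * (A x $ i $ j * partial j \<phi> x))"
      by (rule integral_by_parts[OF C1(1) C1(6) axis_Basis K]) (simp add: d\<phi>0)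
    also have "\<dots> = - (LINT x|lborel. (A x $ j $ i * partial i V x) * partial j \<phi> x)"
      by (simp add: A_sym[of _ i j] mult_ac)
    also have "\<dots> = (LINT x|lborel. partial j (\<lambda>z. A z $ j $ i * partial i V z) x * \<phi> x)"
      using integral_by_parts[OF C1(5) C1(2) axis_Basis K \<phi>0] by simp
    finally show ?thesis .
  qed
  have 1: "(LINT x|lborel. V x * partial i (\<lambda>z. b z $ i * \<phi> z) x) =
      - (LINT x|lborel. b x $ i * partial i V x * \<phi> x)" for i
    using integral_by_parts[OF C1(1) C1(7) axis_Basis K] \<phi>0 by (simp add: mult_ac)
  have "(LINT x|lborel. V x * L_adj A b \<phi> x) =
     (LINT x|lborel. (\<Sum>i\<in>UNIV. \<Sum>j\<in>UNIV. V x * partial i (\<lambda>z. A z $ i $ j * partial j \<phi> z) x)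
       - (\<Sum>i\<in>UNIV. V x * partial i (\<lambda>z. b z $ i * \<phi> z) x))"
    by (simp add: L_adj_def sum_distrib_left right_diff_distrib)
  also have "\<dots> = (\<Sum>i\<in>UNIV. \<Sum>j\<in>UNIV. LINT x|lborel. V x * partial i (\<lambda>z. A z $ i $ j * partial j \<phi> z) x)
       - (\<Sum>i\<in>UNIV. LINT x|lborel. V x * partial i (\<lambda>z. b z $ i * \<phi> z) x)"
  proof -
    have i2: "integrable lborel (\<lambda>x. V x * partial i (\<lambda>z. A z $ i $ j * partial j \<phi> z) x)" for i j
    proof (rule int)
      show "V x * partial i (\<lambda>z. A z $ i $ j * partial j \<phi> z) x = 0" if "x \<notin> K" for x
        using dir_deriv_eq_0_outside[OF compact_imp_closed[OF K] _ that] d\<phi>0 by simp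
    qed (intro continuous_intros cont)
    have i1: "integrable lborel (\<lambda>x. V x * partial i (\<lambda>z. b z $ i * \<phi> z) x)" for i
    proof (rule int)
      show "V x * partial i (\<lambda>z. b z $ i * \<phi> z) x = 0" if "x \<notin> K" for x
        using dir_deriv_eq_0_outside[OF compact_imp_closed[OF K] _ that] \<phi>0 by simp
    qed (intro continuous_intros cont)
    show ?thesis
      by (subst Bochner_Integration.integral_diff) (auto intro!: i1 i2 simp: Bochner_Integration.integral_sum i1 i2)
  qed
  also have "\<dots> = (\<Sum>i\<in>UNIV. \<Sum>j\<in>UNIV. LINT x|lborel. partial j (\<lambda>z. A z $ j $ i * partial i V z) x * \<phi> x)
       + (\<Sum>i\<in>UNIV. LINT x|lborel. b x $ i * partial i V x * \<phi> x)"
    by (simp add: 1 2 sum_negf)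
  also have "\<dots> = (\<Sum>i\<in>UNIV. \<Sum>j\<in>UNIV. LINT x|lborel. partial i (\<lambda>z. A z $ i $ j * partial j V z) x * \<phi> x)
       + (\<Sum>i\<in>UNIV. LINT x|lborel. b x $ i * partial i V x * \<phi> x)"
    by (subst sum.swap) simp
  also have "\<dots> = (LINT x|lborel. (\<Sum>i\<in>UNIV. \<Sum>j\<in>UNIV. partial i (\<lambda>z. A z $ i $ j * partial j V z) x * \<phi> x)
       + (\<Sum>i\<in>UNIV. b x $ i * partial i V x * \<phi> x))"
  proof -
    have i2: "integrable lborel (\<lambda>x. partial i (\<lambda>z. A z $ i $ j * partial j V z) x * \<phi> x)" for i j
      by (rule int) (auto intro!: continuous_intros cont simp: \<phi>0)
    have i1: "integrable lborel (\<lambda>x. b x $ i * partial i V x * \<phi> x)" for i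
      by (rule int) (auto intro!: continuous_intros cont simp: \<phi>0)
    show ?thesis
      by (subst Bochner_Integration.integral_add) (auto intro!: i1 i2 simp: Bochner_Integration.integral_sum i1 i2)
  qed
  also have "\<dots> = (LINT x|lborel. L_op A b V x * \<phi> x)"
    by (simp add: L_op_def sum_distrib_right distrib_right)
  finally show ?thesis .
qed

end

section \<open>Comparison of integrals\<close>

lemma abs_integral_le_AE:
  fixes F G :: "'a \<Rightarrow> real"
  assumes "integrable M G" "AE y in M. \<bar>F y\<bar> \<le> G y"
  shows "\<bar>LINT y|M. F y\<bar> \<le> (LINT y|M. G y)"
proof (cases "integrable M F")
  case True
  have "\<bar>LINT y|M. F y\<bar> \<le> (LINT y|M. \<bar>F y\<bar>)" by (rule integral_abs_bound)
  also have "\<dots> \<le> (LINT y|M. G y)"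
    using True assms by (intro integral_mono_AE) auto
  finally show ?thesis .
next
  case False
  have "0 \<le> (LINT y|M. G y)"
    by (rule integral_nonneg_AE) (use assms(2) in \<open>auto elim: eventually_mono\<close>)
  then show ?thesis using False by (simp add: not_integrable_integral_eq)
qed

lemma abs_set_integral_le:
  fixes F G :: "'a \<Rightarrow> real"
  assumes "set_integrable M S G" "\<And>y. y \<in> S \<Longrightarrow> \<bar>F y\<bar> \<le> G y"
  shows "\<bar>LINT y:S|M. F y\<bar> \<le> (LINT y:S|M. G y)"
  unfolding set_lebesgue_integral_def
  using assms by (intro abs_integral_le_AE AE_I2) (auto simp: set_integrable_def indicator_def)

lemma set_integral_pos:
  fixes f :: "'a::euclidean_space \<Rightarrow> real"
  assumes U: "open U" "U \<noteq> {}" and f: "set_integrable lborel U f" "\<And>y. y \<in> U \<Longrightarrow> f y > 0"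
  shows "(LINT y:U|lborel. f y) > 0"
proof -
  let ?g = "\<lambda>y. indicator U y *\<^sub>R f y"
  have nn: "?g y \<ge> 0" for y using f(2)[of y] by (auto simp: indicator_def)
  have "(LINT y|lborel. ?g y) \<noteq> 0"
  proof
    assume "(LINT y|lborel. ?g y) = 0"
    then have "AE y in lborel. ?g y = 0"
      using integral_nonneg_eq_0_iff_AE[of lborel ?g] nn f(1) by (simp add: set_integrable_def)
    then have "AE y in lborel. y \<notin> U"
      by (rule eventually_mono) (use f(2) in \<open>fastforce simp: indicator_def\<close>)
    then have "U \<in> null_sets lborel" using U by (simp add: AE_iff_null_sets)
    then show False using open_not_null_sets_lborel[OF U] by simp
  qed
  moreover have "(LINT y|lborel. ?g y) \<ge> 0" by (rule Bochner_Integration.integral_nonneg) (rule nn)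
  ultimately show ?thesis by (simp add: set_lebesgue_integral_def)
qed

lemma set_integrable_bounded_mult:
  fixes f g :: "'a::euclidean_space \<Rightarrow> real"
  assumes "set_integrable lborel S f" "g \<in> borel_measurable borel" "\<And>y. y \<in> S \<Longrightarrow> \<bar>g y\<bar> \<le> B"
  shows "set_integrable lborel S (\<lambda>y. g y * f y)"
  unfolding set_integrable_def
proof (rule Bochner_Integration.integrable_bound)
  have i: "integrable lborel (\<lambda>y. indicator S y *\<^sub>R f y)"
    using assms(1) by (simp add: set_integrable_def)
  then show "integrable lborel (\<lambda>y. B * (indicator S y *\<^sub>R f y))"
    by (rule integrable_mult_right)
  have "(\<lambda>y. indicator S y *\<^sub>R (g y * f y)) = (\<lambda>y. g y * (indicator S y *\<^sub>R f y))"
    by auto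
  also have "\<dots> \<in> borel_measurable lborel"
    using borel_measurable_integrable[OF i] assms(2) by simp
  finally show "(\<lambda>y. indicator S y *\<^sub>R (g y * f y)) \<in> borel_measurable lborel" .
  show "AE y in lborel. norm (indicator S y *\<^sub>R (g y * f y)) \<le> norm (B * (indicator S y *\<^sub>R f y))"
  proof (rule AE_I2)
    fix y
    show "norm (indicator S y *\<^sub>R (g y * f y)) \<le> norm (B * (indicator S y *\<^sub>R f y))"
      using assms(3)[of y] by (auto simp: indicator_def abs_mult intro!: mult_right_mono)
  qed
qed

text \<open>How the weighted approximations end: the left-hand side depends neither on \<open>\<epsilon>\<close>
  nor on the approximating test function.\<close>

lemma abs_le_times_imp_0:
  fixes a B :: real
  assumes "\<And>e. e > 0 \<Longrightarrow> \<bar>a\<bar> \<le> e * B"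
  shows "a = 0"
proof (rule ccontr)
  assume "a \<noteq> 0"
  have "\<bar>a\<bar> \<le> \<bar>a\<bar> / (2 * (\<bar>B\<bar> + 1)) * B"
    using \<open>a \<noteq> 0\<close> by (intro assms) simp
  also have "\<dots> \<le> \<bar>a\<bar> / (2 * (\<bar>B\<bar> + 1)) * (\<bar>B\<bar> + 1)"
    by (intro mult_left_mono) auto
  also have "\<dots> = \<bar>a\<bar> / 2" by (simp add: field_simps)
  finally show False using \<open>a \<noteq> 0\<close> by simp
qed

section \<open>Continuous functions with compact support\<close>

definition Cc :: "('a::euclidean_space \<Rightarrow> real) \<Rightarrow> bool" where
  "Cc f \<longleftrightarrow> continuous_on UNIV f \<and> compact (supp f)"

lemma test_function_Cc: "\<phi> \<in> test_functions S \<Longrightarrow> Cc \<phi>"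
  unfolding Cc_def
  using test_functions_smooth smooth_on_imp_continuous_on test_functions_compact_supp by blast

lemma Cc_bump: "R > 0 \<Longrightarrow> Cc (bump c R)"
  by (rule test_function_Cc[OF bump_test])

lemma Cc_measurable: "Cc f \<Longrightarrow> f \<in> borel_measurable borel"
  unfolding Cc_def by (blast intro: borel_measurable_continuous_onI)

lemma Cc_bounded:
  assumes "Cc f"
  obtains B where "B \<ge> 0" "\<And>x. \<bar>f x\<bar> \<le> B"
  using bounded_of_compact_support[of f "supp f"] assms eq_0_outside_supp[of _ f] unfolding Cc_def by metis

lemma Cc_integrable: "Cc f \<Longrightarrow> integrable lborel f"
  unfolding Cc_def
  using integrable_continuous_compact_support[of f "supp f", OF _ _ eq_0_outside_supp[of _ f]] by blast

lemma Cc_supp_ball: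
  assumes "Cc f"
  obtains R where "R > 0" "supp f \<subseteq> ball 0 R"
proof -
  have "bounded (supp f)" using assms unfolding Cc_def by (blast intro: compact_imp_bounded)
  then obtain R where "R > 0" "\<forall>x\<in>supp f. norm x < R" by (auto simp only: bounded_pos_less)
  then have "supp f \<subseteq> ball 0 R" by (simp add: subset_iff)
  with \<open>R > 0\<close> show ?thesis by (rule that)
qed

lemma Cc_approximation:
  assumes "Cc f"
  obtains R where "R > 0"
    "\<forall>e>0. \<exists>\<phi>\<in>test_functions UNIV. \<forall>x. \<bar>f x - \<phi> x\<bar> \<le> e * bump 0 R x"
proof -
  obtain R where R: "R > 0" "supp f \<subseteq> ball 0 R" using Cc_supp_ball[OF assms] .
  have f: "continuous_on UNIV f" using assms unfolding Cc_def by blast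
  show ?thesis
  proof (rule that[OF R(1)], intro allI impI)
    fix e :: real assume "e > 0"
    then show "\<exists>\<phi>\<in>test_functions UNIV. \<forall>x. \<bar>f x - \<phi> x\<bar> \<le> e * bump 0 R x"
      using test_approximation[where f = f, OF f closed_closure R(2) eq_0_outside_supp[of _ f] R(1)] by metis
  qed
qed

lemma eventually_norm_gt:
  assumes "\<forall>\<^sub>F x in at_infinity. P x"
  obtains R where "R > 0" "\<And>x. norm x > R \<Longrightarrow> P x"
proof -
  obtain R where R: "\<And>x. norm x \<ge> R \<Longrightarrow> P x" using assms by (auto simp: eventually_at_infinity)
  show ?thesis by (rule that[of "\<bar>R\<bar> + 1"]) (use R in auto)
qed

section \<open>The fundamental solution and its balls\<close>

text \<open>The common setting of the potential theory and the maximum principle. Hypoellipticity is added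
  where distributional solutions are identified with smooth ones.\<close>

locale jensen_setting = smooth_coefficients A b
  for A :: "real^'n \<Rightarrow> real^'n^'n" and b :: "real^'n \<Rightarrow> real^'n" +
  fixes \<Gamma> :: "real^'n \<Rightarrow> real^'n \<Rightarrow> real"
  assumes A_symmetric: "\<And>x. transpose (A x) = A x"
    and A_nonneg: "\<And>x \<xi>. (A x *v \<xi>) \<bullet> \<xi> \<ge> 0"
    and fund: "fundamental_solution A b \<Gamma>"
    and pj: "poisson_jensen A b \<Gamma>"
begin

lemma \<Gamma>_nonneg: "x \<noteq> y \<Longrightarrow> \<Gamma> x y \<ge> 0"
  using fund by (simp add: fundamental_solution_def)

lemma \<Gamma>_continuous: "continuous_on {(x, y). x \<noteq> y} (\<lambda>(x, y). \<Gamma> x y)"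
  using fund smooth_on_imp_continuous_on unfolding fundamental_solution_def by blast

lemma \<Gamma>_continuous_snd: "continuous_on (- {x}) (\<Gamma> x)"
proof -
  have "continuous_on (- {x}) ((\<lambda>(x, y). \<Gamma> x y) \<circ> (\<lambda>y. (x, y)))"
    by (intro continuous_on_compose continuous_on_subset[OF \<Gamma>_continuous]) (auto intro!: continuous_intros)
  then show ?thesis by (simp add: comp_def)
qed

lemma \<Gamma>_continuous_fst: "continuous_on (- {y}) (\<lambda>x. \<Gamma> x y)"
proof -
  have "continuous_on (- {y}) ((\<lambda>(x, y). \<Gamma> x y) \<circ> (\<lambda>x. (x, y)))"
    by (intro continuous_on_compose continuous_on_subset[OF \<Gamma>_continuous]) (auto intro!: continuous_intros)
  then show ?thesis by (simp add: comp_def)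
qed

lemma \<Gamma>_measurable [measurable]: "\<Gamma> x \<in> borel_measurable borel"
proof -
  have "(\<lambda>y. if y \<in> - {x} then \<Gamma> x y else \<Gamma> x y) \<in> borel_measurable borel"
    by (intro borel_measurable_continuous_on_if \<Gamma>_continuous_snd) auto
  then show ?thesis by simp
qed

lemma \<Gamma>_set_integrable: "compact K \<Longrightarrow> set_integrable lborel K (\<Gamma> x)"
  using fund by (simp add: fundamental_solution_def locally_integrable_def)

text \<open>Passing from the supremum to its members requires boundedness above: for \<open>y\<close> outside the ball
  the function \<open>\<Gamma> \<cdot> y\<close> is continuous on it.\<close>

lemma \<Gamma>_small_snd:
  assumes "e > 0"
  obtains R where "R > 0" "\<And>y. norm y > R \<Longrightarrow> \<Gamma> x y < e"
proof -
  define M where "M = norm x + 1"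
  have M: "M > 0" by (simp add: M_def add_nonneg_pos)
  have "((\<lambda>y. SUP x\<in>cball 0 M. \<Gamma> x y) \<longlongrightarrow> 0) at_infinity"
    using fund M by (simp add: fundamental_solution_def)
  then have "\<forall>\<^sub>F y in at_infinity. (SUP x\<in>cball 0 M. \<Gamma> x y) < e"
    using assms by (rule order_tendstoD(2))
  then obtain R where R: "R > 0" "\<And>y. norm y > R \<Longrightarrow> (SUP x\<in>cball 0 M. \<Gamma> x y) < e"
    using eventually_norm_gt by blast
  show ?thesis
  proof (rule that[of "max R M"])
    fix y :: "real^'n" assume y: "norm y > max R M"
    have "compact ((\<lambda>x. \<Gamma> x y) ` cball 0 M)"
      by (intro compact_continuous_image continuous_on_subset[OF \<Gamma>_continuous_fst]) (use y in auto)
    then have "bdd_above ((\<lambda>x. \<Gamma> x y) ` cball 0 M)"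
      by (intro bounded_imp_bdd_above compact_imp_bounded)
    then have "\<Gamma> x y \<le> (SUP x\<in>cball 0 M. \<Gamma> x y)"
      by (rule cSUP_upper[rotated]) (simp add: M_def)
    then show "\<Gamma> x y < e" using R(2)[of y] y by simp
  qed (use R M in auto)
qed

lemma \<Gamma>_small_fst:
  assumes "e > 0" "M > 0"
  obtains R where "R > 0" "\<And>x y. norm x > R \<Longrightarrow> norm y \<le> M \<Longrightarrow> x \<noteq> y \<and> \<Gamma> x y < e"
proof -
  have "((\<lambda>x. SUP y\<in>cball 0 M. \<Gamma> x y) \<longlongrightarrow> 0) at_infinity"
    using fund assms by (simp add: fundamental_solution_def)
  then have "\<forall>\<^sub>F x in at_infinity. (SUP y\<in>cball 0 M. \<Gamma> x y) < e"
    using assms(1) by (rule order_tendstoD(2))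
  then obtain R where R: "R > 0" "\<And>x. norm x > R \<Longrightarrow> (SUP y\<in>cball 0 M. \<Gamma> x y) < e"
    using eventually_norm_gt by blast
  show ?thesis
  proof (rule that[of "max R M"])
    fix x y :: "real^'n" assume x: "norm x > max R M" and y: "norm y \<le> M"
    have "compact (\<Gamma> x ` cball 0 M)"
      by (intro compact_continuous_image continuous_on_subset[OF \<Gamma>_continuous_snd]) (use x in auto)
    then have "bdd_above (\<Gamma> x ` cball 0 M)"
      by (intro bounded_imp_bdd_above compact_imp_bounded)
    then have "\<Gamma> x y \<le> (SUP y\<in>cball 0 M. \<Gamma> x y)"
      by (rule cSUP_upper[rotated]) (use y in simp)
    then show "x \<noteq> y \<and> \<Gamma> x y < e" using R(2)[of x] x y by auto
  qed (use R assms in auto)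
qed

lemma L_ball_subset_cball:
  assumes "r > 0"
  obtains R where "L_ball \<Gamma> r x \<subseteq> cball 0 R"
proof -
  obtain R where "\<And>y. norm y > R \<Longrightarrow> \<Gamma> x y < 1 / r"
    using \<Gamma>_small_snd[of "1 / r"] assms by (metis zero_less_divide_1_iff)
  then have "L_ball \<Gamma> r x \<subseteq> cball 0 R"
    by (force simp: L_ball_def not_le[symmetric])
  then show ?thesis by (rule that)
qed

lemma L_ball_open: "open (L_ball \<Gamma> r x)"
proof -
  have "L_ball \<Gamma> r x = \<Gamma> x -` {1 / r<..} \<inter> - {x}"
    by (auto simp: L_ball_def)
  also have "open \<dots>"
    using \<Gamma>_continuous_snd[of x] by (subst (asm) continuous_on_open_vimage) auto
  finally show ?thesis .
qed

lemma L_ball_sets [measurable]: "L_ball \<Gamma> r x \<in> sets borel"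
  by (rule borel_open[OF L_ball_open])

lemma L_ball_mono: "0 < \<rho> \<Longrightarrow> \<rho> \<le> r \<Longrightarrow> L_ball \<Gamma> \<rho> x \<subseteq> L_ball \<Gamma> r x"
  using frac_le[of 1 1 \<rho> r] by (auto simp: L_ball_def)

text \<open>A consequence of the blow-up of \<open>\<Gamma> x\<close> at \<open>x\<close>; it makes the normalizing factor \<open>Q\<^sub>r\<close> positive.\<close>

lemma L_ball_nonempty: "L_ball \<Gamma> r x \<noteq> {}"
proof
  assume *: "L_ball \<Gamma> r x = {}"
  have "Limsup (at x) (\<lambda>y. ereal (\<Gamma> x y)) \<le> ereal (1 / r)"
    by (rule Limsup_bounded) (use * in \<open>auto simp: L_ball_def eventually_at_filter not_less intro!: always_eventually\<close>)
  moreover have "Limsup (at x) (\<lambda>y. ereal (\<Gamma> x y)) = \<infinity>"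
    using fund by (simp add: fundamental_solution_def)
  ultimately show False by simp
qed

text \<open>Away from \<open>x\<close> the function \<open>\<Gamma> x\<close> is bounded: by compactness on a large ball without
  \<open>ball x \<delta>\<close>, and by its decay farther out.\<close>

lemma L_ball_shrinks:
  assumes "\<delta> > 0"
  obtains r0 where "r0 > 0" "L_ball \<Gamma> r0 x \<subseteq> ball x \<delta>"
proof -
  obtain R where R: "R > 0" "\<And>y. norm y > R \<Longrightarrow> \<Gamma> x y < 1"
    using \<Gamma>_small_snd[of 1] by (metis zero_less_one)
  have "compact (\<Gamma> x ` (cball 0 R - ball x \<delta>))"
    by (intro compact_continuous_image continuous_on_subset[OF \<Gamma>_continuous_snd] compact_diff)
      (use assms in auto)
  then obtain B where B: "B > 0" "\<And>y. y \<in> cball 0 R - ball x \<delta> \<Longrightarrow> \<bar>\<Gamma> x y\<bar> \<le> B"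
    using compact_imp_bounded[of "\<Gamma> x ` (cball 0 R - ball x \<delta>)"] unfolding bounded_pos by auto
  show ?thesis
  proof (rule that[of "1 / (B + 1)"])
    show "L_ball \<Gamma> (1 / (B + 1)) x \<subseteq> ball x \<delta>"
    proof
      fix y assume "y \<in> L_ball \<Gamma> (1 / (B + 1)) x"
      then have y: "\<Gamma> x y > B + 1" by (simp add: L_ball_def)
      then have "norm y \<le> R" using R(2)[of y] B(1) by (meson not_le less_trans less_add_same_cancel2 less_asym)
      with B(2)[of y] y show "y \<in> ball x \<delta>" by force
    qed
  qed (use B in simp)
qed

section \<open>Potentials\<close>

definition pot :: "(real^'n \<Rightarrow> real) \<Rightarrow> real^'n \<Rightarrow> real" where
  "pot f x = (LINT y|lborel. \<Gamma> x y * f y)"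

lemma \<Gamma>_mult_integrable:
  assumes "Cc f"
  shows "integrable lborel (\<lambda>y. \<Gamma> x y * f y)"
proof -
  obtain B where B: "\<And>x. \<bar>f x\<bar> \<le> B" using Cc_bounded[OF assms] by blast
  have "compact (supp f)" using assms unfolding Cc_def by blast
  then have "set_integrable lborel (supp f) (\<lambda>y. f y * \<Gamma> x y)"
    by (rule set_integrable_bounded_mult[OF \<Gamma>_set_integrable Cc_measurable[OF assms] B])
  moreover have "(\<lambda>y. indicator (supp f) y *\<^sub>R (f y * \<Gamma> x y)) = (\<lambda>y. \<Gamma> x y * f y)"
    using eq_0_outside_supp[of _ f] by (intro ext) (auto simp: indicator_def)
  ultimately show ?thesis by (simp add: set_integrable_def)
qed

lemma pot_diff: "Cc f \<Longrightarrow> Cc g \<Longrightarrow> pot f x - pot g x = (LINT y|lborel. \<Gamma> x y * (f y - g y))"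
  by (simp add: pot_def \<Gamma>_mult_integrable right_diff_distrib)

text \<open>Positivity of \<open>\<Gamma>\<close> transports a weighted error bound from functions to their potentials. The
  value of \<open>\<Gamma> x\<close> at \<open>x\<close> is arbitrary, hence the estimate under the integral only almost everywhere.\<close>

lemma pot_approx:
  assumes "Cc f" "Cc g" "Cc h" "\<And>y. \<bar>f y - g y\<bar> \<le> e * h y"
  shows "\<bar>pot f x - pot g x\<bar> \<le> e * pot h x"
proof -
  have "\<bar>LINT y|lborel. \<Gamma> x y * (f y - g y)\<bar> \<le> (LINT y|lborel. e * (\<Gamma> x y * h y))"
  proof (rule abs_integral_le_AE)
    show "integrable lborel (\<lambda>y. e * (\<Gamma> x y * h y))"
      by (intro integrable_mult_right \<Gamma>_mult_integrable assms)
    show "AE y in lborel. \<bar>\<Gamma> x y * (f y - g y)\<bar> \<le> e * (\<Gamma> x y * h y)"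
      using AE_lborel_singleton[of x]
    proof eventually_elim
      case (elim y)
      have "\<bar>\<Gamma> x y * (f y - g y)\<bar> = \<Gamma> x y * \<bar>f y - g y\<bar>"
        using \<Gamma>_nonneg[of x y] elim by (simp add: abs_mult)
      also have "\<dots> \<le> \<Gamma> x y * (e * h y)"
        using \<Gamma>_nonneg[of x y] elim assms(4) by (intro mult_left_mono) auto
      finally show ?case by (simp add: mult_ac)
    qed
  qed
  then show ?thesis using assms by (simp add: pot_diff pot_def[of h])
qed

lemma pot_nonneg:
  assumes "\<And>y. f y \<ge> 0"
  shows "pot f x \<ge> 0"
  unfolding pot_def
proof (rule integral_nonneg_AE)
  show "AE y in lborel. 0 \<le> \<Gamma> x y * f y"
    using AE_lborel_singleton[of x] by eventually_elim (use \<Gamma>_nonneg assms in auto)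
qed

lemma pot_test_C2: "\<phi> \<in> test_functions UNIV \<Longrightarrow> Ck_on 2 UNIV (pot \<phi>)"
  using fund unfolding fundamental_solution_def pot_def[abs_def] by blast

lemma pot_test_L_op: "\<phi> \<in> test_functions UNIV \<Longrightarrow> L_op A b (pot \<phi>) x = - \<phi> x"
  using fund unfolding fundamental_solution_def pot_def[abs_def] by blast

text \<open>Integrability of each \<open>\<Gamma> x\<close> says nothing about uniformity in \<open>x\<close>. The uniformity comes from
  the potential of the bump: it is continuous, hence locally bounded, and so \<open>pot f\<close> is a locally
  uniform limit of potentials of test functions.\<close>

lemma pot_continuous:
  assumes "Cc f"
  shows "continuous_on UNIV (pot f)"
proof -
  obtain R where R: "R > 0"
    "\<forall>e>0. \<exists>\<phi>\<in>test_functions UNIV. \<forall>x. \<bar>f x - \<phi> x\<bar> \<le> e * bump 0 R x"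
    using Cc_approximation[OF assms] .
  define \<phi> where "\<phi> n = (SOME \<phi>. \<phi> \<in> test_functions UNIV \<and>
      (\<forall>x. \<bar>f x - \<phi> x\<bar> \<le> inverse (real (Suc n)) * bump 0 R x))" for n
  have \<phi>: "\<phi> n \<in> test_functions UNIV" "\<bar>f x - \<phi> n x\<bar> \<le> inverse (real (Suc n)) * bump 0 R x" for n x
    using someI_ex[OF R(2)[THEN spec, of "inverse (real (Suc n))", THEN mp, unfolded Bex_def]] unfolding \<phi>_def by auto
  have app: "\<bar>pot f x - pot (\<phi> n) x\<bar> \<le> inverse (real (Suc n)) * pot (bump 0 R) x" for n x
    by (rule pot_approx[OF assms test_function_Cc[OF \<phi>(1)] Cc_bump[OF R(1)] \<phi>(2)])
  have "isCont (pot f) a" for a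
  proof -
    have "continuous_on (cball a 1) (pot (bump 0 R))"
      using Ck_on_imp_continuous_on[OF pot_test_C2[OF bump_test[OF R(1)]]] continuous_on_subset by blast
    then have "bounded (pot (bump 0 R) ` cball a 1)"
      by (intro compact_imp_bounded compact_continuous_image) auto
    then obtain B where B: "B > 0" "\<And>x. x \<in> cball a 1 \<Longrightarrow> \<bar>pot (bump 0 R) x\<bar> \<le> B"
      unfolding bounded_pos by auto
    have "uniform_limit (ball a 1) (\<lambda>n. pot (\<phi> n)) (pot f) sequentially"
      unfolding uniform_limit_iff
    proof (intro allI impI)
      fix e :: real assume e: "e > 0"
      have "(\<lambda>n. inverse (real (Suc n)) * B) \<longlonglongrightarrow> 0 * B"
        by (intro tendsto_intros LIMSEQ_inverse_real_of_nat)
      then have "\<forall>\<^sub>F n in sequentially. inverse (real (Suc n)) * B < e"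
        using e by (auto dest: order_tendstoD(2))
      then show "\<forall>\<^sub>F n in sequentially. \<forall>x\<in>ball a 1. dist (pot (\<phi> n) x) (pot f x) < e"
      proof eventually_elim
        case (elim n)
        show ?case
        proof
          fix x assume x: "x \<in> ball a 1"
          have "\<bar>pot f x - pot (\<phi> n) x\<bar> \<le> inverse (real (Suc n)) * pot (bump 0 R) x" by (rule app)
          also have "\<dots> \<le> inverse (real (Suc n)) * B"
            using B(2)[of x] x by (intro mult_left_mono) auto
          finally show "dist (pot (\<phi> n) x) (pot f x) < e"
            using elim by (simp add: dist_real_def abs_minus_commute)
        qed
      qed
    qed
    then have "continuous_on (ball a 1) (pot f)"
    proof (rule uniform_limit_theorem[rotated])
      have "continuous_on (ball a 1) (pot (\<phi> n))" for n
        by (rule continuous_on_subset[OF Ck_on_imp_continuous_on[OF pot_test_C2[OF \<phi>(1)]]]) simp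
      then show "\<forall>\<^sub>F n in sequentially. continuous_on (ball a 1) (pot (\<phi> n))"
        by (intro always_eventually allI)
    qed simp
    then show ?thesis by (auto simp: continuous_on_eq_continuous_at)
  qed
  then show ?thesis by (simp add: continuous_on_eq_continuous_at)
qed

text \<open>Far away, \<open>\<Gamma> x\<close> is uniformly small on the support of \<open>f\<close>.\<close>

lemma pot_vanishes_at_infinity:
  assumes "Cc f"
  shows "(pot f \<longlongrightarrow> 0) at_infinity"
proof (rule tendstoI)
  fix e :: real assume e: "e > 0"
  obtain M where M: "M > 0" "supp f \<subseteq> ball 0 M" using Cc_supp_ball[OF assms] .
  define I where "I = (LINT y|lborel. \<bar>f y\<bar>)"
  have I: "I \<ge> 0" unfolding I_def by simp
  define e' where "e' = e / (I + 1)"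
  have e': "e' > 0" using e I by (simp add: e'_def)
  obtain R where R: "R > 0" "\<And>x y. norm x > R \<Longrightarrow> norm y \<le> M \<Longrightarrow> x \<noteq> y \<and> \<Gamma> x y < e'"
    using \<Gamma>_small_fst[OF e' M(1)] by blast
  have "\<bar>pot f x\<bar> < e" if x: "norm x > R" for x
  proof -
    have "\<bar>LINT y|lborel. \<Gamma> x y * f y\<bar> \<le> (LINT y|lborel. e' * \<bar>f y\<bar>)"
    proof (rule abs_integral_le_AE, rule integrable_mult_right)
      show "integrable lborel (\<lambda>y. \<bar>f y\<bar>)" using Cc_integrable[OF assms] by simp
      show "AE y in lborel. \<bar>\<Gamma> x y * f y\<bar> \<le> e' * \<bar>f y\<bar>"
      proof (rule AE_I2)
        fix y
        show "\<bar>\<Gamma> x y * f y\<bar> \<le> e' * \<bar>f y\<bar>"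
        proof (cases "y \<in> supp f")
          case True
          then have "norm y \<le> M" using M(2) by auto
          with R(2)[OF x this] \<Gamma>_nonneg[of x y] show ?thesis
            by (simp add: abs_mult mult_right_mono)
        next
          case False
          then have "f y = 0" by (rule eq_0_outside_supp)
          then show ?thesis by simp
        qed
      qed
    qed
    also have "\<dots> = e' * I" by (simp add: I_def)
    also have "\<dots> < e" using e I by (simp add: e'_def field_simps)
    finally show ?thesis by (simp add: pot_def)
  qed
  then show "\<forall>\<^sub>F x in at_infinity. dist (pot f x) 0 < e"
    unfolding eventually_at_infinity by (intro exI[of _ "R + 1"]) auto
qed

text \<open>For test functions \<open>\<psi>\<close> in place of \<open>f\<close> this is Green's identity with \<open>L (pot \<psi>) = - \<psi>\<close>; the
  defect for \<open>f\<close> is at most \<open>\<epsilon>\<close> times a constant that depends only on the bump and on \<open>\<phi>\<close>.\<close>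

lemma pot_solves_weakly:
  assumes "Cc f" "\<phi> \<in> test_functions UNIV"
  shows "(LINT x|lborel. pot f x * L_adj A b \<phi> x) = - (LINT x|lborel. f x * \<phi> x)"
proof -
  obtain R where R: "R > 0"
    "\<forall>e>0. \<exists>\<psi>\<in>test_functions UNIV. \<forall>x. \<bar>f x - \<psi> x\<bar> \<le> e * bump 0 R x"
    using Cc_approximation[OF assms(1)] .
  let ?L = "L_adj A b \<phi>"
  have L_cont: "continuous_on UNIV ?L"
    using assms(2) by (intro L_adj_continuous smooth_on_imp_Ck_on test_functions_smooth)
  have L0: "?L x = 0" if "x \<notin> supp \<phi>" for x
    by (rule L_adj_eq_0_outside[OF closed_closure eq_0_outside_supp[of _ \<phi>] that])
  have K: "compact (supp \<phi>)" by (rule test_functions_compact_supp[OF assms(2)])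
  have \<phi>_cont: "continuous_on UNIV \<phi>" using test_function_Cc[OF assms(2)] by (simp add: Cc_def)
  have int_L: "integrable lborel (\<lambda>x. w x * ?L x)" and int_L_abs: "integrable lborel (\<lambda>x. w x * \<bar>?L x\<bar>)"
    and int_\<phi>: "integrable lborel (\<lambda>x. w x * \<phi> x)" and int_\<phi>_abs: "integrable lborel (\<lambda>x. w x * \<bar>\<phi> x\<bar>)"
    if w: "continuous_on UNIV w" for w
  proof -
    note int = integrable_continuous_compact_support[OF _ K]
    show "integrable lborel (\<lambda>x. w x * ?L x)"
    proof (rule int)
      show "continuous_on UNIV (\<lambda>x. w x * ?L x)"
        by (rule continuous_on_mult[OF w L_cont])
    qed (simp add: L0)
    show "integrable lborel (\<lambda>x. w x * \<bar>?L x\<bar>)"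
    proof (rule int)
      show "continuous_on UNIV (\<lambda>x. w x * \<bar>?L x\<bar>)"
        by (rule continuous_on_mult[OF w continuous_on_rabs[OF L_cont]])
    qed (simp add: L0)
    show "integrable lborel (\<lambda>x. w x * \<phi> x)"
    proof (rule int)
      show "continuous_on UNIV (\<lambda>x. w x * \<phi> x)"
        by (rule continuous_on_mult[OF w \<phi>_cont])
    qed (simp add: eq_0_outside_supp[of _ \<phi>])
    show "integrable lborel (\<lambda>x. w x * \<bar>\<phi> x\<bar>)"
    proof (rule int)
      show "continuous_on UNIV (\<lambda>x. w x * \<bar>\<phi> x\<bar>)"
        by (rule continuous_on_mult[OF w continuous_on_rabs[OF \<phi>_cont]])
    qed (simp add: eq_0_outside_supp[of _ \<phi>])
  qed
  let ?\<chi> = "bump 0 R"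
  have f_cont: "continuous_on UNIV f" using assms(1) by (simp add: Cc_def)
  have p\<chi>_cont: "continuous_on UNIV (pot ?\<chi>)" by (rule pot_continuous[OF Cc_bump[OF R(1)]])
  have "(LINT x|lborel. pot f x * ?L x) + (LINT x|lborel. f x * \<phi> x) = 0"
  proof (rule abs_le_times_imp_0)
    fix e :: real assume e: "e > 0"
    obtain \<psi> where \<psi>: "\<psi> \<in> test_functions UNIV" "\<And>x. \<bar>f x - \<psi> x\<bar> \<le> e * ?\<chi> x"
      using R(2)[THEN spec, THEN mp, OF e] by (elim bexE) simp
    have \<psi>_cont: "continuous_on UNIV \<psi>" using test_function_Cc[OF \<psi>(1)] by (simp add: Cc_def)
    have "(LINT x|lborel. pot \<psi> x * ?L x) = (LINT x|lborel. L_op A b (pot \<psi>) x * \<phi> x)"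
      by (rule Green_identity[OF A_symmetric pot_test_C2[OF \<psi>(1)] assms(2)])
    also have "\<dots> = - (LINT x|lborel. \<psi> x * \<phi> x)" using pot_test_L_op[OF \<psi>(1)] by simp
    finally have \<psi>_eq: "(LINT x|lborel. pot \<psi> x * ?L x) = - (LINT x|lborel. \<psi> x * \<phi> x)" .
    have "(LINT x|lborel. (pot f x - pot \<psi> x) * ?L x) =
        (LINT x|lborel. pot f x * ?L x) - (LINT x|lborel. pot \<psi> x * ?L x)"
      unfolding left_diff_distrib
      by (rule Bochner_Integration.integral_diff[OF int_L[OF pot_continuous[OF assms(1)]]
            int_L[OF pot_continuous[OF test_function_Cc[OF \<psi>(1)]]]])
    moreover have "(LINT x|lborel. (f x - \<psi> x) * \<phi> x) =
        (LINT x|lborel. f x * \<phi> x) - (LINT x|lborel. \<psi> x * \<phi> x)"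
      unfolding left_diff_distrib
      by (rule Bochner_Integration.integral_diff[OF int_\<phi>[OF f_cont] int_\<phi>[OF \<psi>_cont]])
    ultimately have "(LINT x|lborel. pot f x * ?L x) + (LINT x|lborel. f x * \<phi> x) =
        (LINT x|lborel. (pot f x - pot \<psi> x) * ?L x) + (LINT x|lborel. (f x - \<psi> x) * \<phi> x)"
      using \<psi>_eq by linarith
    moreover have "\<bar>LINT x|lborel. (pot f x - pot \<psi> x) * ?L x\<bar> \<le> e * (LINT x|lborel. pot ?\<chi> x * \<bar>?L x\<bar>)"
    proof -
      have "\<bar>LINT x|lborel. (pot f x - pot \<psi> x) * ?L x\<bar> \<le> (LINT x|lborel. e * (pot ?\<chi> x * \<bar>?L x\<bar>))"
      proof (rule abs_integral_le_AE)
        show "integrable lborel (\<lambda>x. e * (pot ?\<chi> x * \<bar>?L x\<bar>))"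
          by (rule integrable_mult_right) (rule int_L_abs[OF p\<chi>_cont])
        have "\<bar>(pot f x - pot \<psi> x) * ?L x\<bar> \<le> e * (pot ?\<chi> x * \<bar>?L x\<bar>)" for x
          using mult_right_mono[OF pot_approx[OF assms(1) test_function_Cc[OF \<psi>(1)] Cc_bump[OF R(1)] \<psi>(2)]
              abs_ge_zero[of "?L x"]]
          by (simp only: abs_mult mult.assoc)
        then show "AE x in lborel. \<bar>(pot f x - pot \<psi> x) * ?L x\<bar> \<le> e * (pot ?\<chi> x * \<bar>?L x\<bar>)"
          by (rule AE_I2)
      qed
      also have "\<dots> = e * (LINT x|lborel. pot ?\<chi> x * \<bar>?L x\<bar>)"
        by (rule integral_mult_right_zero)
      finally show ?thesis .
    qed
    moreover have "\<bar>LINT x|lborel. (f x - \<psi> x) * \<phi> x\<bar> \<le> e * (LINT x|lborel. ?\<chi> x * \<bar>\<phi> x\<bar>)"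
    proof -
      have "\<bar>LINT x|lborel. (f x - \<psi> x) * \<phi> x\<bar> \<le> (LINT x|lborel. e * (?\<chi> x * \<bar>\<phi> x\<bar>))"
      proof (rule abs_integral_le_AE)
        show "integrable lborel (\<lambda>x. e * (?\<chi> x * \<bar>\<phi> x\<bar>))"
          by (rule integrable_mult_right) (rule int_\<phi>_abs[OF bump_continuous])
        have "\<bar>(f x - \<psi> x) * \<phi> x\<bar> \<le> e * (?\<chi> x * \<bar>\<phi> x\<bar>)" for x
          using mult_right_mono[OF \<psi>(2) abs_ge_zero[of "\<phi> x"], of x] by (simp only: abs_mult mult.assoc)
        then show "AE x in lborel. \<bar>(f x - \<psi> x) * \<phi> x\<bar> \<le> e * (?\<chi> x * \<bar>\<phi> x\<bar>)"
          by (rule AE_I2)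
      qed
      also have "\<dots> = e * (LINT x|lborel. ?\<chi> x * \<bar>\<phi> x\<bar>)"
        by (rule integral_mult_right_zero)
      finally show ?thesis .
    qed
    ultimately show "\<bar>(LINT x|lborel. pot f x * ?L x) + (LINT x|lborel. f x * \<phi> x)\<bar> \<le>
        e * ((LINT x|lborel. pot ?\<chi> x * \<bar>?L x\<bar>) + (LINT x|lborel. ?\<chi> x * \<bar>\<phi> x\<bar>))"
      unfolding distrib_left by linarith
  qed
  then show ?thesis by simp
qed

section \<open>Averages over the balls\<close>

definition kernel :: "real^'n \<Rightarrow> real^'n \<Rightarrow> real" where
  "kernel x y = ((A y *v grad (\<Gamma> x) y) \<bullet> grad (\<Gamma> x) y) / (\<Gamma> x y)\<^sup>2"

lemma kernel_nonneg: "kernel x y \<ge> 0"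
  unfolding kernel_def by (intro divide_nonneg_nonneg A_nonneg) simp

lemma M_avg_eq: "M_avg A \<Gamma> r u x = 1 / r * (LINT y:L_ball \<Gamma> r x|lborel. u y * kernel x y)"
  by (simp add: M_avg_def kernel_def)

lemma poisson_jensen_UNIV: "Ck_on 2 UNIV v \<Longrightarrow> r > 0 \<Longrightarrow> v x = M_avg A \<Gamma> r v x - N_avg \<Gamma> r (L_op A b v) x"
  using pj unfolding poisson_jensen_def by blast

lemma N_avg_0: "N_avg \<Gamma> r (\<lambda>_. 0) x = 0"
  by (simp add: N_avg_def set_lebesgue_integral_def)

lemma L_op_const: "L_op A b (\<lambda>_. c) x = 0"
proof -
  have "partial i (\<lambda>_::real^'n. d::real) = (\<lambda>_. 0)" for i d
    by (rule ext, rule dir_deriv_eqI[where f' = "\<lambda>_. 0"]) simp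
  then show ?thesis by (simp add: L_op_def)
qed

text \<open>The Poisson--Jensen formula for the constant \<open>1\<close>: the averages \<open>M\<^sub>r\<close> have total mass \<open>1\<close>.\<close>

lemma M_avg_1: "r > 0 \<Longrightarrow> M_avg A \<Gamma> r (\<lambda>_. 1) x = 1"
proof -
  assume r: "r > 0"
  have "Ck_on 2 UNIV (\<lambda>_::real^'n. 1::real)"
    by (rule smooth_on_imp_Ck_on[OF bump_algebra_smooth[OF bump_algebra.const]])
  moreover have "L_op A b (\<lambda>_. 1) = (\<lambda>_. 0)" using L_op_const by blast
  ultimately show ?thesis using poisson_jensen_UNIV[of "\<lambda>_. 1" r x] r N_avg_0[of r x] by simp
qed

text \<open>A Bochner integral that is not \<open>0\<close> is the integral of an integrable function, so
  integrability of the kernel follows from its total mass.\<close>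

lemma kernel_integrable:
  assumes "r > 0"
  shows "set_integrable lborel (L_ball \<Gamma> r x) (kernel x)"
proof (rule ccontr)
  assume "\<not> ?thesis"
  then have "(LINT y:L_ball \<Gamma> r x|lborel. kernel x y) = 0"
    by (simp add: set_integrable_def set_lebesgue_integral_def not_integrable_integral_eq)
  then show False using M_avg_1[OF assms, of x] by (simp add: M_avg_eq)
qed

lemma continuous_bounded_on_L_ball:
  assumes "r > 0" "continuous_on UNIV u"
  obtains B :: real where "\<And>y. y \<in> L_ball \<Gamma> r x \<Longrightarrow> \<bar>u y\<bar> \<le> B"
proof -
  obtain R where R: "L_ball \<Gamma> r x \<subseteq> cball 0 R" using L_ball_subset_cball[OF assms(1)] .
  have "continuous_on (cball 0 R) u" by (rule continuous_on_subset[OF assms(2)]) simp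
  then have "bounded (u ` cball 0 R)"
    by (rule compact_imp_bounded[OF compact_continuous_image[OF _ compact_cball]])
  then obtain B where "\<forall>y\<in>cball 0 R. \<bar>u y\<bar> \<le> B" by (auto simp: bounded_iff)
  then show ?thesis using R that by blast
qed

lemma M_integrable:
  assumes "r > 0" "continuous_on UNIV u"
  shows "set_integrable lborel (L_ball \<Gamma> r x) (\<lambda>y. u y * kernel x y)"
proof -
  obtain B where "\<And>y. y \<in> L_ball \<Gamma> r x \<Longrightarrow> \<bar>u y\<bar> \<le> B"
    using continuous_bounded_on_L_ball[OF assms] by blast
  then show ?thesis
    using set_integrable_bounded_mult[OF kernel_integrable[OF assms(1)] borel_measurable_continuous_onI[OF assms(2)]]
    by blast
qed

lemma M_avg_diff:
  assumes "r > 0" "continuous_on UNIV u" "continuous_on UNIV v"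
  shows "M_avg A \<Gamma> r (\<lambda>y. u y - v y) x = M_avg A \<Gamma> r u x - M_avg A \<Gamma> r v x"
  unfolding M_avg_eq left_diff_distrib
  by (subst set_integral_diff(2)[OF M_integrable[OF assms(1,2)] M_integrable[OF assms(1,3)]])
    (rule right_diff_distrib)

lemma M_avg_cmult: "M_avg A \<Gamma> r (\<lambda>y. c * u y) x = c * M_avg A \<Gamma> r u x"
  unfolding M_avg_eq mult.assoc set_integral_mult_right by (rule mult.left_commute)

lemma M_avg_mono:
  assumes r: "r > 0" and "continuous_on UNIV u" "continuous_on UNIV v" "\<And>y. u y \<le> v y"
  shows "M_avg A \<Gamma> r u x \<le> M_avg A \<Gamma> r v x"
proof -
  have "(LINT y:L_ball \<Gamma> r x|lborel. u y * kernel x y) \<le> (LINT y:L_ball \<Gamma> r x|lborel. v y * kernel x y)"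
    by (rule set_integral_mono[OF M_integrable[OF r assms(2)] M_integrable[OF r assms(3)]])
      (rule mult_right_mono[OF assms(4) kernel_nonneg])
  then show ?thesis unfolding M_avg_eq using r by (intro mult_left_mono) auto
qed

lemma M_avg_abs_le:
  assumes "r > 0" "continuous_on UNIV u" "continuous_on UNIV v" "\<And>y. \<bar>u y\<bar> \<le> v y"
  shows "\<bar>M_avg A \<Gamma> r u x\<bar> \<le> M_avg A \<Gamma> r v x"
proof -
  have "M_avg A \<Gamma> r u x \<le> M_avg A \<Gamma> r v x"
    by (rule M_avg_mono[OF assms(1,2,3)]) (use assms(4) abs_le_D1 in blast)
  moreover have "M_avg A \<Gamma> r (\<lambda>y. -1 * u y) x \<le> M_avg A \<Gamma> r v x"
  proof (rule M_avg_mono[OF assms(1) continuous_on_mult_left[OF assms(2)] assms(3)])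
    show "-1 * u y \<le> v y" for y using abs_le_D2[OF assms(4)[of y]] by simp
  qed
  ultimately show ?thesis unfolding M_avg_cmult by simp
qed

definition inner_avg :: "real \<Rightarrow> (real^'n \<Rightarrow> real) \<Rightarrow> real^'n \<Rightarrow> real" where
  "inner_avg \<rho> w x = (LINT y:L_ball \<Gamma> \<rho> x|lborel. (\<Gamma> x y - 1 / \<rho>) * w y)"

lemma N_avg_eq: "N_avg \<Gamma> r w x = 1 / r * (LINT \<rho>:{0<..<r}|lborel. inner_avg \<rho> w x)"
  by (simp add: N_avg_def inner_avg_def)

lemma L_ball_\<Gamma>_integrable:
  assumes "r > 0" "continuous_on UNIV w"
  shows "set_integrable lborel (L_ball \<Gamma> r x) (\<lambda>y. \<Gamma> x y * w y)"
proof -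
  obtain R where R: "L_ball \<Gamma> r x \<subseteq> cball 0 R" using L_ball_subset_cball[OF assms(1)] .
  obtain B where B: "\<And>y. y \<in> L_ball \<Gamma> r x \<Longrightarrow> \<bar>w y\<bar> \<le> B"
    using continuous_bounded_on_L_ball[OF assms] by blast
  have "set_integrable lborel (L_ball \<Gamma> r x) (\<Gamma> x)"
    by (rule set_integrable_subset[OF \<Gamma>_set_integrable[OF compact_cball] _ R]) simp
  from set_integrable_bounded_mult[OF this borel_measurable_continuous_onI[OF assms(2)] B]
  show ?thesis by (simp only: mult.commute)
qed

lemma inner_integrand_bound:
  assumes "y \<in> L_ball \<Gamma> \<rho> x" "\<rho> > 0"
  shows "0 < \<Gamma> x y - 1 / \<rho>" "\<Gamma> x y - 1 / \<rho> \<le> \<Gamma> x y"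
  using assms by (auto simp: L_ball_def)

lemma inner_integrable:
  assumes "\<rho> > 0" "continuous_on UNIV w"
  shows "set_integrable lborel (L_ball \<Gamma> \<rho> x) (\<lambda>y. (\<Gamma> x y - 1 / \<rho>) * w y)"
proof (rule set_integrable_bound[OF L_ball_\<Gamma>_integrable[OF assms]])
  have [measurable]: "w \<in> borel_measurable borel" by (rule borel_measurable_continuous_onI[OF assms(2)])
  show "set_borel_measurable lborel (L_ball \<Gamma> \<rho> x) (\<lambda>y. (\<Gamma> x y - 1 / \<rho>) * w y)"
    unfolding set_borel_measurable_def by measurable
  show "AE y in lborel. y \<in> L_ball \<Gamma> \<rho> x \<longrightarrow> norm ((\<Gamma> x y - 1 / \<rho>) * w y) \<le> norm (\<Gamma> x y * w y)"
  proof (rule AE_I2, rule impI)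
    fix y assume "y \<in> L_ball \<Gamma> \<rho> x"
    from inner_integrand_bound[OF this assms(1)]
    show "norm ((\<Gamma> x y - 1 / \<rho>) * w y) \<le> norm (\<Gamma> x y * w y)"
      by (auto simp only: abs_mult real_norm_def intro!: mult_right_mono)
  qed
qed

text \<open>Measurability in \<open>\<rho>\<close> comes from joint measurability of the integrand. The bound \<open>B\<close> is uniform
  in \<open>\<rho>\<close> because the balls increase with the radius.\<close>

lemma inner_avg_integrable:
  assumes "r > 0" "continuous_on UNIV w"
  shows "set_integrable lborel {0<..<r} (\<lambda>\<rho>. inner_avg \<rho> w x)"
proof -
  have [measurable]: "w \<in> borel_measurable borel" by (rule borel_measurable_continuous_onI[OF assms(2)])
  have meas: "(\<lambda>\<rho>. inner_avg \<rho> w x) \<in> borel_measurable borel"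
  proof -
    have "(\<lambda>\<rho>. LINT y|lborel. (if y \<noteq> x \<and> \<Gamma> x y > 1 / \<rho> then (\<Gamma> x y - 1 / \<rho>) * w y else 0))
        \<in> borel_measurable borel"
      by measurable
    moreover have "inner_avg \<rho> w x =
        (LINT y|lborel. (if y \<noteq> x \<and> \<Gamma> x y > 1 / \<rho> then (\<Gamma> x y - 1 / \<rho>) * w y else 0))" for \<rho>
      unfolding inner_avg_def set_lebesgue_integral_def
      by (rule Bochner_Integration.integral_cong) (auto simp: L_ball_def)
    ultimately show ?thesis by simp
  qed
  have w_abs: "continuous_on UNIV (\<lambda>y. \<bar>w y\<bar>)" by (rule continuous_on_rabs[OF assms(2)])
  define B where "B = (LINT y:L_ball \<Gamma> r x|lborel. \<Gamma> x y * \<bar>w y\<bar>)"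
  have "\<bar>inner_avg \<rho> w x\<bar> \<le> B" if \<rho>: "\<rho> \<in> {0<..<r}" for \<rho>
    unfolding inner_avg_def B_def set_lebesgue_integral_def
  proof (rule abs_integral_le_AE)
    show "integrable lborel (\<lambda>y. indicator (L_ball \<Gamma> r x) y *\<^sub>R (\<Gamma> x y * \<bar>w y\<bar>))"
      using L_ball_\<Gamma>_integrable[OF assms(1) w_abs] unfolding set_integrable_def .
    show "AE y in lborel. \<bar>indicator (L_ball \<Gamma> \<rho> x) y *\<^sub>R ((\<Gamma> x y - 1 / \<rho>) * w y)\<bar>
        \<le> indicator (L_ball \<Gamma> r x) y *\<^sub>R (\<Gamma> x y * \<bar>w y\<bar>)"
    proof (rule AE_I2)
      fix y
      show "\<bar>indicator (L_ball \<Gamma> \<rho> x) y *\<^sub>R ((\<Gamma> x y - 1 / \<rho>) * w y)\<bar>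
        \<le> indicator (L_ball \<Gamma> r x) y *\<^sub>R (\<Gamma> x y * \<bar>w y\<bar>)"
      proof (cases "y \<in> L_ball \<Gamma> \<rho> x")
        case True
        then have "y \<in> L_ball \<Gamma> r x" using L_ball_mono[of \<rho> r x] \<rho> by auto
        with True inner_integrand_bound[OF True] \<rho> show ?thesis
          by (simp add: abs_mult mult_right_mono)
      next
        case False
        have "0 \<le> \<Gamma> x y * \<bar>w y\<bar>" if "y \<in> L_ball \<Gamma> r x"
          using that \<Gamma>_nonneg[of x y] by (auto simp: L_ball_def)
        with False show ?thesis by (simp add: indicator_def)
      qed
    qed
  qed
  moreover have "set_integrable lborel {0<..<r} (\<lambda>\<rho>. 1::real)"
    unfolding set_integrable_def using integrable_real_indicator[of "{0<..<r}" lborel] assms(1) by simp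
  ultimately have "set_integrable lborel {0<..<r} (\<lambda>\<rho>. inner_avg \<rho> w x * 1)"
    using set_integrable_bounded_mult meas by blast
  then show ?thesis by simp
qed

lemma N_avg_diff:
  assumes r: "r > 0" and u: "continuous_on UNIV u" and v: "continuous_on UNIV v"
  shows "N_avg \<Gamma> r (\<lambda>y. u y - v y) x = N_avg \<Gamma> r u x - N_avg \<Gamma> r v x"
proof -
  have "inner_avg \<rho> (\<lambda>y. u y - v y) x = inner_avg \<rho> u x - inner_avg \<rho> v x" if "\<rho> > 0" for \<rho>
    unfolding inner_avg_def right_diff_distrib[of "\<Gamma> x _ - 1 / \<rho>"]
    by (rule set_integral_diff(2)[OF inner_integrable[OF that u] inner_integrable[OF that v]])
  then have "(LINT \<rho>:{0<..<r}|lborel. inner_avg \<rho> (\<lambda>y. u y - v y) x) =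
      (LINT \<rho>:{0<..<r}|lborel. inner_avg \<rho> u x - inner_avg \<rho> v x)"
    by (intro set_lebesgue_integral_cong) auto
  also have "\<dots> = (LINT \<rho>:{0<..<r}|lborel. inner_avg \<rho> u x) - (LINT \<rho>:{0<..<r}|lborel. inner_avg \<rho> v x)"
    by (rule set_integral_diff(2)[OF inner_avg_integrable[OF r u] inner_avg_integrable[OF r v]])
  finally show ?thesis unfolding N_avg_eq by (simp only: right_diff_distrib)
qed

lemma N_avg_cmult: "N_avg \<Gamma> r (\<lambda>y. c * w y) x = c * N_avg \<Gamma> r w x"
proof -
  have "inner_avg \<rho> (\<lambda>y. c * w y) x = c * inner_avg \<rho> w x" for \<rho>
    unfolding inner_avg_def mult.left_commute[of _ c] by (rule set_integral_mult_right)
  then show ?thesis unfolding N_avg_eq by (simp only: set_integral_mult_right mult.left_commute)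
qed

lemma N_avg_abs_le:
  assumes r: "r > 0" and w: "continuous_on UNIV w" and v: "continuous_on UNIV v"
    and le: "\<And>y. y \<in> L_ball \<Gamma> r x \<Longrightarrow> \<bar>w y\<bar> \<le> v y"
  shows "\<bar>N_avg \<Gamma> r w x\<bar> \<le> N_avg \<Gamma> r v x"
proof -
  have "\<bar>inner_avg \<rho> w x\<bar> \<le> inner_avg \<rho> v x" if \<rho>: "\<rho> \<in> {0<..<r}" for \<rho>
    unfolding inner_avg_def
  proof (rule abs_set_integral_le)
    show "set_integrable lborel (L_ball \<Gamma> \<rho> x) (\<lambda>y. (\<Gamma> x y - 1 / \<rho>) * v y)"
      using inner_integrable[OF _ v] \<rho> by simp
    fix y assume y: "y \<in> L_ball \<Gamma> \<rho> x"
    then have "\<bar>w y\<bar> \<le> v y" using le L_ball_mono[of \<rho> r x] \<rho> by auto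
    with inner_integrand_bound[OF y] \<rho> show "\<bar>(\<Gamma> x y - 1 / \<rho>) * w y\<bar> \<le> (\<Gamma> x y - 1 / \<rho>) * v y"
      by (simp add: abs_mult mult_left_mono)
  qed
  then have "\<bar>LINT \<rho>:{0<..<r}|lborel. inner_avg \<rho> w x\<bar> \<le> (LINT \<rho>:{0<..<r}|lborel. inner_avg \<rho> v x)"
    by (rule abs_set_integral_le[OF inner_avg_integrable[OF r v]])
  then show ?thesis unfolding N_avg_eq using r by (simp add: abs_mult divide_right_mono)
qed

lemma Q_avg_pos:
  assumes "r > 0"
  shows "Q_avg \<Gamma> r x > 0"
proof -
  have "inner_avg \<rho> (\<lambda>_. 1) x > 0" if "\<rho> \<in> {0<..<r}" for \<rho>
    unfolding inner_avg_def
  proof (rule set_integral_pos[OF L_ball_open L_ball_nonempty])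
    show "set_integrable lborel (L_ball \<Gamma> \<rho> x) (\<lambda>y. (\<Gamma> x y - 1 / \<rho>) * 1)"
      by (rule inner_integrable) (use that in auto)
    show "0 < (\<Gamma> x y - 1 / \<rho>) * 1" if "y \<in> L_ball \<Gamma> \<rho> x" for y
      using that \<open>\<rho> \<in> {0<..<r}\<close> by (simp add: L_ball_def)
  qed
  then have "(LINT \<rho>:{0<..<r}|lborel. inner_avg \<rho> (\<lambda>_. 1) x) > 0"
    using assms by (intro set_integral_pos inner_avg_integrable) auto
  then show ?thesis using assms by (simp add: Q_avg_def N_avg_eq)
qed

text \<open>The Poisson--Jensen formula with \<open>L (pot f) = - f\<close>, extended from test functions to continuous
  \<open>f\<close>, for which \<open>pot f\<close> need not be of class \<open>C\<^sup>2\<close>.\<close>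

lemma jensen_pot:
  assumes f: "Cc f" and r: "r > 0"
  shows "M_avg A \<Gamma> r (pot f) x - pot f x = - N_avg \<Gamma> r f x"
proof -
  obtain R where R: "R > 0"
    "\<forall>e>0. \<exists>\<phi>\<in>test_functions UNIV. \<forall>x. \<bar>f x - \<phi> x\<bar> \<le> e * bump 0 R x"
    using Cc_approximation[OF f] .
  let ?g = "bump 0 R"
  have g: "Cc ?g" by (rule Cc_bump[OF R(1)])
  have cont: "continuous_on UNIV g" if "Cc g" for g :: "real^'n \<Rightarrow> real"
    using that unfolding Cc_def by blast
  have "M_avg A \<Gamma> r (pot f) x - pot f x + N_avg \<Gamma> r f x = 0"
  proof (rule abs_le_times_imp_0)
    fix e :: real assume e: "e > 0"
    obtain \<phi> where \<phi>: "\<phi> \<in> test_functions UNIV" "\<And>x. \<bar>f x - \<phi> x\<bar> \<le> e * ?g x"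
      using R(2)[THEN spec, THEN mp, OF e] by (elim bexE) simp
    have \<phi>': "Cc \<phi>" by (rule test_function_Cc[OF \<phi>(1)])
    have "L_op A b (pot \<phi>) = (\<lambda>y. -1 * \<phi> y)" using pot_test_L_op[OF \<phi>(1)] by auto
    then have J: "M_avg A \<Gamma> r (pot \<phi>) x - pot \<phi> x + N_avg \<Gamma> r \<phi> x = 0"
      using poisson_jensen_UNIV[OF pot_test_C2[OF \<phi>(1)] r, of x] N_avg_cmult[of r "-1" \<phi> x] by simp
    have app: "\<bar>pot f y - pot \<phi> y\<bar> \<le> e * pot ?g y" for y
      by (rule pot_approx[OF f \<phi>' g \<phi>(2)])
    have "\<bar>M_avg A \<Gamma> r (\<lambda>y. pot f y - pot \<phi> y) x\<bar> \<le> M_avg A \<Gamma> r (\<lambda>y. e * pot ?g y) x"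
      by (rule M_avg_abs_le[OF r continuous_on_diff[OF pot_continuous[OF f] pot_continuous[OF \<phi>']]
            continuous_on_mult_left[OF pot_continuous[OF g]] app])
    then have 1: "\<bar>M_avg A \<Gamma> r (pot f) x - M_avg A \<Gamma> r (pot \<phi>) x\<bar> \<le> e * M_avg A \<Gamma> r (pot ?g) x"
      unfolding M_avg_cmult M_avg_diff[OF r pot_continuous[OF f] pot_continuous[OF \<phi>']] .
    have "\<bar>N_avg \<Gamma> r (\<lambda>y. f y - \<phi> y) x\<bar> \<le> N_avg \<Gamma> r (\<lambda>y. e * ?g y) x"
      by (rule N_avg_abs_le[OF r continuous_on_diff[OF cont[OF f] cont[OF \<phi>']]
            continuous_on_mult_left[OF cont[OF g]] \<phi>(2)])
    then have 2: "\<bar>N_avg \<Gamma> r f x - N_avg \<Gamma> r \<phi> x\<bar> \<le> e * N_avg \<Gamma> r ?g x"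
      unfolding N_avg_cmult N_avg_diff[OF r cont[OF f] cont[OF \<phi>']] .
    show "\<bar>M_avg A \<Gamma> r (pot f) x - pot f x + N_avg \<Gamma> r f x\<bar>
        \<le> e * (M_avg A \<Gamma> r (pot ?g) x + pot ?g x + N_avg \<Gamma> r ?g x)"
      unfolding distrib_left using 1 2 app[of x] J by linarith
  qed
  then show ?thesis by linarith
qed

text \<open>By \<open>jensen_pot\<close> the quotient equals \<open>- N\<^sub>r f / Q\<^sub>r\<close>, a weighted mean of \<open>- f\<close> over
  balls that shrink to \<open>x\<close>.\<close>

lemma pot_asymptotic:
  assumes f: "Cc f"
  shows "((\<lambda>r. (M_avg A \<Gamma> r (pot f) x - pot f x) / Q_avg \<Gamma> r x) \<longlongrightarrow> - f x) (at_right 0)"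
proof (rule tendstoI)
  fix e :: real assume e: "e > 0"
  have f_cont: "continuous_on UNIV f" using f unfolding Cc_def by blast
  obtain \<delta> where \<delta>: "\<delta> > 0" "\<And>y. dist y x < \<delta> \<Longrightarrow> \<bar>f y - f x\<bar> < e / 2"
    using f_cont[unfolded continuous_on_iff, rule_format, of x "e / 2"] e by (auto simp: dist_real_def)
  obtain r0 where r0: "r0 > 0" "L_ball \<Gamma> r0 x \<subseteq> ball x \<delta>" using L_ball_shrinks[OF \<delta>(1)] .
  have "dist ((M_avg A \<Gamma> r (pot f) x - pot f x) / Q_avg \<Gamma> r x) (- f x) < e" if r: "0 < r" "r < r0" for r
  proof -
    have Q: "Q_avg \<Gamma> r x > 0" by (rule Q_avg_pos[OF r(1)])
    have "\<bar>N_avg \<Gamma> r (\<lambda>y. f y - f x * 1) x\<bar> \<le> N_avg \<Gamma> r (\<lambda>y. e / 2 * 1) x"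
    proof (rule N_avg_abs_le[OF r(1)])
      fix y assume "y \<in> L_ball \<Gamma> r x"
      then have "dist y x < \<delta>" using L_ball_mono[of r r0 x] r r0(2) by (auto simp: dist_commute)
      then show "\<bar>f y - f x * 1\<bar> \<le> e / 2 * 1" using \<delta>(2)[of y] by simp
    qed (auto intro!: continuous_on_diff f_cont)
    then have "\<bar>N_avg \<Gamma> r f x - f x * Q_avg \<Gamma> r x\<bar> \<le> e / 2 * Q_avg \<Gamma> r x"
      unfolding N_avg_diff[OF r(1) f_cont continuous_on_const] N_avg_cmult Q_avg_def[symmetric] .
    then have "\<bar>N_avg \<Gamma> r f x / Q_avg \<Gamma> r x - f x\<bar> \<le> e / 2"
      using Q by (simp add: field_simps abs_le_iff)
    then show ?thesis
      unfolding jensen_pot[OF f r(1)] dist_real_def using e by (simp add: abs_minus_commute)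
  qed
  then show "\<forall>\<^sub>F r in at_right 0. dist ((M_avg A \<Gamma> r (pot f) x - pot f x) / Q_avg \<Gamma> r x) (- f x) < e"
    unfolding eventually_at_right_field using r0(1) by blast
qed

section \<open>The maximum principle and uniqueness\<close>

text \<open>Subtracting \<open>\<epsilon> pot g\<close> makes the asymptotic average operator strictly positive where the bump
  \<open>g\<close> is positive, which is impossible at a maximum. As \<open>pot g \<ge> 0\<close>, the function decreases by
  this, so the bound \<open>m / 2\<close> outside the ball persists and the maximum over the ball is global;
  global maximality is needed because the \<open>L\<close>-balls around \<open>z\<close> may leave the ball.\<close>

lemma asymptotic_maximum_principle:
  assumes w: "continuous_on UNIV w" and lim: "(w \<longlongrightarrow> 0) at_infinity"
    and asym: "\<And>x. ((\<lambda>r. (M_avg A \<Gamma> r w x - w x) / Q_avg \<Gamma> r x) \<longlongrightarrow> 0) (at_right 0)"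
  shows "w a \<le> 0"
proof (rule ccontr)
  assume "\<not> w a \<le> 0"
  define m where "m = w a"
  have m: "m > 0" using \<open>\<not> w a \<le> 0\<close> by (simp add: m_def)
  have "\<forall>\<^sub>F x in at_infinity. w x < m / 2"
    using lim m by (intro order_tendstoD(2)) auto
  then obtain R where R: "R > 0" "\<And>x. norm x > R \<Longrightarrow> w x < m / 2"
    using eventually_norm_gt by blast
  have aR: "norm a \<le> R" using R(2)[of a] m by (force simp: m_def)
  define g where "g = bump (0::real^'n) (R + 1)"
  have g: "Cc g" unfolding g_def using R(1) by (intro Cc_bump) simp
  have p0: "pot g x \<ge> 0" for x by (rule pot_nonneg) (simp add: g_def bump_nonneg)
  \<comment> \<open>Small enough to keep the value at \<open>a\<close> above \<open>m / 2\<close>.\<close>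
  define \<epsilon> where "\<epsilon> = m / (4 * (pot g a + 1))"
  have \<epsilon>: "\<epsilon> > 0" using m p0[of a] by (simp add: \<epsilon>_def)
  have "\<epsilon> * pot g a \<le> \<epsilon> * (pot g a + 1)" using \<epsilon> by simp
  also have "\<dots> = m / 4" using p0[of a] by (simp add: \<epsilon>_def field_simps)
  finally have \<epsilon>a: "\<epsilon> * pot g a \<le> m / 4" .
  define v where "v x = w x - \<epsilon> * pot g x" for x
  have v_cont: "continuous_on UNIV v"
    unfolding v_def by (rule continuous_on_diff[OF w continuous_on_mult_left[OF pot_continuous[OF g]]])
  obtain z where z: "z \<in> cball 0 R" "\<And>y. y \<in> cball 0 R \<Longrightarrow> v y \<le> v z"
    using continuous_attains_sup[OF compact_cball _ continuous_on_subset[OF v_cont], of 0 R] R(1)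
    by (metis cball_eq_empty not_less_iff_gr_or_eq subset_UNIV)
  have va: "v a > m / 2" using \<epsilon>a m by (simp add: v_def m_def)
  have vmax: "v y \<le> v z" for y
  proof (cases "norm y \<le> R")
    case False
    have "v y \<le> w y" using \<epsilon> p0[of y] by (simp add: v_def)
    also have "\<dots> < m / 2" using R(2) False by simp
    also have "\<dots> < v z" using va z(2)[of a] aR by simp
    finally show ?thesis by simp
  qed (use z(2) in simp)
  have "((\<lambda>r. (M_avg A \<Gamma> r w z - w z) / Q_avg \<Gamma> r z - \<epsilon> * ((M_avg A \<Gamma> r (pot g) z - pot g z) / Q_avg \<Gamma> r z))
      \<longlongrightarrow> 0 - \<epsilon> * (- g z)) (at_right 0)"
    by (intro tendsto_diff tendsto_mult_left asym pot_asymptotic g)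
  moreover have "\<forall>\<^sub>F r in at_right 0.
      (M_avg A \<Gamma> r w z - w z) / Q_avg \<Gamma> r z - \<epsilon> * ((M_avg A \<Gamma> r (pot g) z - pot g z) / Q_avg \<Gamma> r z) \<le> 0"
    unfolding eventually_at_right_field
  proof (intro exI[of _ 1] conjI allI impI)
    fix r :: real assume r: "0 < r"
    have "M_avg A \<Gamma> r v z \<le> M_avg A \<Gamma> r (\<lambda>_. v z * 1) z"
      by (rule M_avg_mono[OF r v_cont continuous_on_const]) (simp add: vmax)
    also have "\<dots> = v z" unfolding M_avg_cmult M_avg_1[OF r] by simp
    finally have "(M_avg A \<Gamma> r v z - v z) / Q_avg \<Gamma> r z \<le> 0"
      using Q_avg_pos[OF r, of z] by (simp add: divide_le_0_iff)
    moreover have "M_avg A \<Gamma> r v z = M_avg A \<Gamma> r w z - \<epsilon> * M_avg A \<Gamma> r (pot g) z"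
      unfolding v_def M_avg_diff[OF r w continuous_on_mult_left[OF pot_continuous[OF g]]] M_avg_cmult ..
    ultimately show "(M_avg A \<Gamma> r w z - w z) / Q_avg \<Gamma> r z - \<epsilon> * ((M_avg A \<Gamma> r (pot g) z - pot g z) / Q_avg \<Gamma> r z) \<le> 0"
      by (simp add: v_def diff_divide_distrib right_diff_distrib)
  qed simp
  ultimately have "0 - \<epsilon> * (- g z) \<le> 0"
    by (rule tendsto_upperbound) simp
  moreover have "g z > 0"
    using bump_pos_iff[of "R + 1" 0 z] z(1) R(1) by (simp add: g_def)
  ultimately show False using \<epsilon> by (simp add: mult_le_0_iff)
qed

lemma asymptotic_uniqueness:
  assumes w: "continuous_on UNIV w" and lim: "(w \<longlongrightarrow> 0) at_infinity"
    and asym: "\<And>x. ((\<lambda>r. (M_avg A \<Gamma> r w x - w x) / Q_avg \<Gamma> r x) \<longlongrightarrow> 0) (at_right 0)"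
  shows "w a = 0"
proof -
  have "((\<lambda>r. (M_avg A \<Gamma> r (\<lambda>y. -1 * w y) x - -1 * w x) / Q_avg \<Gamma> r x) \<longlongrightarrow> 0) (at_right 0)" for x
  proof -
    have "(M_avg A \<Gamma> r (\<lambda>y. -1 * w y) x - -1 * w x) / Q_avg \<Gamma> r x = -1 * ((M_avg A \<Gamma> r w x - w x) / Q_avg \<Gamma> r x)" for r
      unfolding M_avg_cmult by (simp add: diff_divide_distrib)
    then have eq: "(\<lambda>r. (M_avg A \<Gamma> r (\<lambda>y. -1 * w y) x - -1 * w x) / Q_avg \<Gamma> r x) =
        (\<lambda>r. -1 * ((M_avg A \<Gamma> r w x - w x) / Q_avg \<Gamma> r x))"
      by (rule ext)
    show ?thesis unfolding eq using tendsto_mult_left[OF asym[of x], of "-1"] by simp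
  qed
  moreover have "((\<lambda>y. -1 * w y) \<longlongrightarrow> 0) at_infinity"
    using tendsto_mult_left[OF lim, of "-1"] by simp
  ultimately have "-1 * w a \<le> 0"
    by (intro asymptotic_maximum_principle continuous_on_mult_left w)
  with asymptotic_maximum_principle[OF assms, of a] show ?thesis by simp
qed

lemma Cc_vanishes_at_infinity:
  fixes u :: "real^'n \<Rightarrow> real"
  assumes "Cc u"
  shows "(u \<longlongrightarrow> 0) at_infinity"
proof -
  obtain R where R: "R > 0" "supp u \<subseteq> ball 0 R" using Cc_supp_ball[OF assms] .
  have "u x = 0" if "norm x \<ge> R" for x
    by (rule eq_0_outside_supp) (use R that in auto)
  then have "\<forall>\<^sub>F x in at_infinity. u x = 0" unfolding eventually_at_infinity by blast
  then show ?thesis by (rule tendsto_eventually)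
qed

lemma asymptotic_solution_eq_pot:
  assumes u: "Cc u" and f: "Cc f"
    and asym: "\<And>x. ((\<lambda>r. (M_avg A \<Gamma> r u x - u x) / Q_avg \<Gamma> r x) \<longlongrightarrow> - f x) (at_right 0)"
  shows "u a = pot f a"
proof -
  have u_cont: "continuous_on UNIV u" using u unfolding Cc_def by blast
  have "u a - pot f a = 0"
  proof (rule asymptotic_uniqueness[where w = "\<lambda>y. u y - pot f y"])
    show "continuous_on UNIV (\<lambda>y. u y - pot f y)"
      by (rule continuous_on_diff[OF u_cont pot_continuous[OF f]])
    show "((\<lambda>y. u y - pot f y) \<longlongrightarrow> 0) at_infinity"
      using tendsto_diff[OF Cc_vanishes_at_infinity[OF u] pot_vanishes_at_infinity[OF f]] by simp
    show "((\<lambda>r. (M_avg A \<Gamma> r (\<lambda>y. u y - pot f y) x - (u x - pot f x)) / Q_avg \<Gamma> r x) \<longlongrightarrow> 0) (at_right 0)" for x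
    proof (rule Lim_transform_eventually)
      show "((\<lambda>r. (M_avg A \<Gamma> r u x - u x) / Q_avg \<Gamma> r x - (M_avg A \<Gamma> r (pot f) x - pot f x) / Q_avg \<Gamma> r x) \<longlongrightarrow> 0) (at_right 0)"
        using tendsto_diff[OF asym[of x] pot_asymptotic[OF f, of x]] by simp
      have "\<forall>\<^sub>F r in at_right (0::real). r > 0" by (simp add: eventually_at_right_less)
      then show "\<forall>\<^sub>F r in at_right 0. (M_avg A \<Gamma> r u x - u x) / Q_avg \<Gamma> r x - (M_avg A \<Gamma> r (pot f) x - pot f x) / Q_avg \<Gamma> r x
        = (M_avg A \<Gamma> r (\<lambda>y. u y - pot f y) x - (u x - pot f x)) / Q_avg \<Gamma> r x"
        by eventually_elim (simp add: M_avg_diff u_cont pot_continuous[OF f] diff_divide_distrib)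
    qed
  qed
  then show ?thesis by simp
qed

section \<open>Distributional solutions\<close>

text \<open>By the Poisson--Jensen formula \<open>M\<^sub>r h = h\<close>, so the asymptotic average operator of \<open>h\<close> is \<open>0\<close>.\<close>

lemma smooth_solution_vanishing_at_infinity:
  assumes h: "Ck_on 2 UNIV h" and Lh: "\<And>x. L_op A b h x = 0" and lim: "(h \<longlongrightarrow> 0) at_infinity"
  shows "h a = 0"
proof (rule asymptotic_uniqueness[OF Ck_on_imp_continuous_on[OF h] lim])
  fix x
  have L0: "L_op A b h = (\<lambda>_. 0)" using Lh by blast
  have "\<forall>\<^sub>F r in at_right (0::real). r > 0" by (simp add: eventually_at_right_less)
  then have "\<forall>\<^sub>F r in at_right 0. (M_avg A \<Gamma> r h x - h x) / Q_avg \<Gamma> r x = 0"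
  proof eventually_elim
    case (elim r)
    then show ?case using poisson_jensen_UNIV[OF h, of r x] unfolding L0 N_avg_0 by simp
  qed
  then show "((\<lambda>r. (M_avg A \<Gamma> r h x - h x) / Q_avg \<Gamma> r x) \<longlongrightarrow> 0) (at_right 0)"
    by (rule tendsto_eventually)
qed

text \<open>The difference \<open>w = u - pot f\<close> is a continuous weak solution of \<open>L w = 0\<close>. Hypoellipticity
  provides a smooth \<open>h\<close> that represents the same distribution; both being continuous, \<open>w = h\<close>
  everywhere. Then Green's identity turns the weak equation into the classical one.\<close>

lemma distributional_solution_eq_pot:
  assumes hypo: "hypoelliptic A b" and u: "Cc u" and f: "Cc f"
    and weak: "L_distr_eq A b UNIV (regular_distr u) (\<lambda>x. - f x)"
  shows "u a = pot f a"
proof -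
  have u_cont: "continuous_on UNIV u" using u unfolding Cc_def by blast
  define w where "w x = u x - pot f x" for x
  have w_cont: "continuous_on UNIV w"
    unfolding w_def by (rule continuous_on_diff[OF u_cont pot_continuous[OF f]])
  have test_int: "integrable lborel (\<lambda>x. v x * \<phi> x)"
    if "continuous_on UNIV v" "\<phi> \<in> test_functions UNIV" for v \<phi> :: "real^'n \<Rightarrow> real"
  proof (rule integrable_continuous_compact_support)
    show "continuous_on UNIV (\<lambda>x. v x * \<phi> x)"
      using test_function_Cc[OF that(2)] unfolding Cc_def by (blast intro: continuous_on_mult that(1))
    show "compact (supp \<phi>)" by (rule test_functions_compact_supp[OF that(2)])
    show "v x * \<phi> x = 0" if "x \<notin> supp \<phi>" for x
      using eq_0_outside_supp[OF that] by simp
  qed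
  have w_L: "(LINT x|lborel. w x * L_adj A b \<phi> x) = 0" if \<phi>: "\<phi> \<in> test_functions UNIV" for \<phi>
  proof -
    have c: "continuous_on UNIV (L_adj A b \<phi>)"
      by (rule L_adj_continuous[OF smooth_on_imp_Ck_on[OF test_functions_smooth[OF \<phi>]]])
    have i: "integrable lborel (\<lambda>x. v x * L_adj A b \<phi> x)" if v: "continuous_on UNIV v" for v
    proof (rule integrable_continuous_compact_support[OF continuous_on_mult[OF v c] test_functions_compact_supp[OF \<phi>]])
      show "v x * L_adj A b \<phi> x = 0" if "x \<notin> supp \<phi>" for x
        using L_adj_eq_0_outside[OF closed_closure eq_0_outside_supp[of _ \<phi>] that] by simp
    qed
    have "(LINT x|lborel. w x * L_adj A b \<phi> x) =
        (LINT x|lborel. u x * L_adj A b \<phi> x) - (LINT x|lborel. pot f x * L_adj A b \<phi> x)"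
      unfolding w_def left_diff_distrib
      by (rule Bochner_Integration.integral_diff[OF i[OF u_cont] i[OF pot_continuous[OF f]]])
    also have "(LINT x|lborel. u x * L_adj A b \<phi> x) = - (LINT x|lborel. f x * \<phi> x)"
      using weak \<phi> unfolding L_distr_eq_def regular_distr_def by simp
    also have "(LINT x|lborel. pot f x * L_adj A b \<phi> x) = - (LINT x|lborel. f x * \<phi> x)"
      by (rule pot_solves_weakly[OF f \<phi>])
    finally show ?thesis by simp
  qed
  \<comment> \<open>A continuous function is a distribution of order \<open>0\<close>, with the integral of \<open>\<bar>w\<bar>\<close> over \<open>K\<close>
    as constant.\<close>
  have "distribution_on UNIV (regular_distr w)"
    unfolding distribution_on_def
  proof (intro conjI ballI allI impI)
    fix \<phi> \<psi> :: "real^'n \<Rightarrow> real" and c :: real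
    assume \<phi>: "\<phi> \<in> test_functions UNIV"
    show "regular_distr w (\<lambda>x. c * \<phi> x) = c * regular_distr w \<phi>"
      unfolding regular_distr_def mult.left_commute[of _ c] by (rule integral_mult_right_zero)
    assume \<psi>: "\<psi> \<in> test_functions UNIV"
    show "regular_distr w (\<lambda>x. \<phi> x + \<psi> x) = regular_distr w \<phi> + regular_distr w \<psi>"
      unfolding regular_distr_def distrib_left
      by (rule Bochner_Integration.integral_add[OF test_int[OF w_cont \<phi>] test_int[OF w_cont \<psi>]])
  next
    fix K :: "(real^'n) set" assume K: "compact K \<and> K \<subseteq> UNIV"
    define C where "C = (LINT x:K|lborel. \<bar>w x\<bar>)"
    have w_K: "set_integrable lborel K (\<lambda>x. \<bar>w x\<bar>)"
      unfolding set_integrable_def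
      by (rule borel_integrable_compact) (use K continuous_on_subset[OF continuous_on_rabs[OF w_cont]] in auto)
    show "\<exists>C N. \<forall>\<phi>\<in>test_functions UNIV. supp \<phi> \<subseteq> K \<longrightarrow>
        \<bar>regular_distr w \<phi>\<bar> \<le> C * (\<Sum>vs | set vs \<subseteq> Basis \<and> length vs \<le> N. SUP x. \<bar>iter_deriv vs \<phi> x\<bar>)"
    proof (intro exI[of _ C] exI[of _ 0] ballI impI)
      fix \<phi> :: "real^'n \<Rightarrow> real" assume \<phi>: "\<phi> \<in> test_functions UNIV" "supp \<phi> \<subseteq> K"
      define S where "S = (SUP x. \<bar>\<phi> x\<bar>)"
      obtain B where B: "\<And>x. \<bar>\<phi> x\<bar> \<le> B" using Cc_bounded[OF test_function_Cc[OF \<phi>(1)]] by blast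
      have S: "\<bar>\<phi> x\<bar> \<le> S" for x
        unfolding S_def by (rule cSUP_upper) (use B in \<open>auto intro!: bdd_aboveI2[where M = B]\<close>)
      have "\<bar>LINT x|lborel. w x * \<phi> x\<bar> \<le> (LINT x|lborel. S * (indicator K x *\<^sub>R \<bar>w x\<bar>))"
      proof (rule abs_integral_le_AE)
        show "integrable lborel (\<lambda>x. S * (indicator K x *\<^sub>R \<bar>w x\<bar>))"
          by (rule integrable_mult_right) (use w_K in \<open>simp only: set_integrable_def\<close>)
        have "\<bar>w x * \<phi> x\<bar> \<le> S * (indicator K x *\<^sub>R \<bar>w x\<bar>)" for x
        proof (cases "x \<in> K")
          case True
          then show ?thesis using mult_right_mono[OF S[of x] abs_ge_zero[of "w x"]] by (simp add: abs_mult mult.commute)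
        next
          case False
          then have "\<phi> x = 0" using \<phi>(2) by (intro eq_0_outside_supp) blast
          with False show ?thesis by simp
        qed
        then show "AE x in lborel. \<bar>w x * \<phi> x\<bar> \<le> S * (indicator K x *\<^sub>R \<bar>w x\<bar>)" by (rule AE_I2)
      qed
      also have "\<dots> = S * C"
        unfolding C_def set_lebesgue_integral_def by (rule integral_mult_right_zero)
      finally have "\<bar>regular_distr w \<phi>\<bar> \<le> C * S" by (simp only: regular_distr_def mult.commute)
      moreover have "{vs. set vs \<subseteq> (Basis :: (real^'n) set) \<and> length vs \<le> 0} = {[]}" by auto
      ultimately show "\<bar>regular_distr w \<phi>\<bar> \<le>
          C * (\<Sum>vs | set vs \<subseteq> Basis \<and> length vs \<le> 0. SUP x. \<bar>iter_deriv vs \<phi> x\<bar>)"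
        by (simp add: S_def)
    qed
  qed
  moreover have "smooth_on UNIV (\<lambda>_::real^'n. 0)"
    by (rule bump_algebra_smooth[OF bump_algebra.const])
  moreover have "L_distr_eq A b UNIV (regular_distr w) (\<lambda>_. 0)"
    using w_L unfolding L_distr_eq_def regular_distr_def by simp
  ultimately obtain h where h: "smooth_on UNIV h" "\<And>\<phi>. \<phi> \<in> test_functions UNIV \<Longrightarrow> regular_distr w \<phi> = regular_distr h \<phi>"
    using hypo unfolding hypoelliptic_def by (metis open_UNIV)
  have h_cont: "continuous_on UNIV h" by (rule smooth_on_imp_continuous_on[OF h(1)])
  have "w x - h x = 0" for x
  proof (rule du_Bois_Reymond[OF continuous_on_diff[OF w_cont h_cont]])
    fix \<phi> :: "real^'n \<Rightarrow> real" assume \<phi>: "\<phi> \<in> test_functions UNIV"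
    have "(LINT x|lborel. (w x - h x) * \<phi> x) = regular_distr w \<phi> - regular_distr h \<phi>"
      unfolding regular_distr_def left_diff_distrib
      by (rule Bochner_Integration.integral_diff[OF test_int[OF w_cont \<phi>] test_int[OF h_cont \<phi>]])
    then show "(LINT x|lborel. (w x - h x) * \<phi> x) = 0" using h(2)[OF \<phi>] by simp
  qed
  then have wh: "w = h" by (simp add: fun_eq_iff)
  have w2: "Ck_on 2 UNIV w" unfolding wh by (rule smooth_on_imp_Ck_on[OF h(1)])
  have "w a = 0"
  proof (rule smooth_solution_vanishing_at_infinity[OF w2])
    show "L_op A b w x = 0" for x
    proof (rule du_Bois_Reymond[OF L_op_continuous[OF w2]])
      show "(LINT x|lborel. L_op A b w x * \<phi> x) = 0" if "\<phi> \<in> test_functions UNIV" for \<phi>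
        using Green_identity[OF A_symmetric w2 that] w_L[OF that] by simp
    qed
    show "(w \<longlongrightarrow> 0) at_infinity"
      unfolding w_def
      using tendsto_diff[OF Cc_vanishes_at_infinity[OF u] pot_vanishes_at_infinity[OF f]] by simp
  qed
  then show ?thesis by (simp add: w_def)
qed

end

section \<open>Equivalence of the two notions of solution\<close>

theorem theorem5p1:
  fixes A :: "real^'n \<Rightarrow> real^'n^'n" and b :: "real^'n \<Rightarrow> real^'n"
    and \<Gamma> :: "real^'n \<Rightarrow> real^'n \<Rightarrow> real" and k\<^sub>1 :: 'n
    and f u :: "real^'n \<Rightarrow> real"
  assumes A_smooth: "\<And>i j. smooth_on UNIV (\<lambda>x. A x $ i $ j)"
    and b_smooth: "\<And>i. smooth_on UNIV (\<lambda>x. b x $ i)"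
    and A_symmetric: "\<And>x. transpose (A x) = A x"
    and A_nonneg: "\<And>x \<xi>. (A x *v \<xi>) \<bullet> \<xi> \<ge> 0"
    and A_11: "(INF x. A x $ k\<^sub>1 $ k\<^sub>1) > 0"
    and hypo: "hypoelliptic A b"
    and fund: "fundamental_solution A b \<Gamma>"
    and pj: "poisson_jensen A b \<Gamma>"
    and f_cont: "continuous_on UNIV f" and f_supp: "compact (supp f)"
    and u_cont: "continuous_on UNIV u" and u_supp: "compact (supp u)"
  shows "asymptotic_average_solution A \<Gamma> UNIV u (\<lambda>x. - f x) \<longleftrightarrow>
         L_distr_eq A b UNIV (regular_distr u) (\<lambda>x. - f x)"
proof -
  interpret jensen_setting A b \<Gamma>
    by unfold_locales (fact A_smooth b_smooth A_symmetric A_nonneg fund pj)+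
  have f: "Cc f" and u: "Cc u" using f_cont f_supp u_cont u_supp unfolding Cc_def by blast+
  show ?thesis
  proof
    assume "asymptotic_average_solution A \<Gamma> UNIV u (\<lambda>x. - f x)"
    then have "u = pot f"
      using asymptotic_solution_eq_pot[OF u f] unfolding asymptotic_average_solution_def by blast
    then show "L_distr_eq A b UNIV (regular_distr u) (\<lambda>x. - f x)"
      using pot_solves_weakly[OF f] unfolding L_distr_eq_def regular_distr_def by simp
  next
    assume "L_distr_eq A b UNIV (regular_distr u) (\<lambda>x. - f x)"
    then have "u = pot f" using distributional_solution_eq_pot[OF hypo u f] by blast
    then show "asymptotic_average_solution A \<Gamma> UNIV u (\<lambda>x. - f x)"
      using pot_asymptotic[OF f] pot_continuous[OF f] continuous_on_minus[OF f_cont]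
      unfolding asymptotic_average_solution_def by simp
  qed
qed

end
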